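(* For real $\alpha$ and $\beta$, let $$Q_\alpha(x,y)=(x^2+x+1)y^2+\alpha x(x+1)y+x(x^2+x+1),$$ $$R_\beta(x,y)=(x^2+x+1)y^2+(x^4+\beta x^3+(2\beta-4)x^2+\beta x+1)y+x^2(x^2+x+1).$$ Then for every real $\alpha\ge 4$, $$\mathrm{m}(Q_\alpha)=\mathrm{m}(R_{2+\alpha}),$$ where $\mathrm{m}$ denotes the (logarithmic) Mahler measure.
   Context: The (logarithmic) Mahler measure of a non-zero rational function $P\in\mathbb{C}(x_1,\dots,x_n)$ is $$\mathrm{m}(P):=\frac{1}{(2\pi i)^n}\int_{\mathbb{T}^n}\log|P(x_1,\dots,x_n)|\,\frac{dx_1}{x_1}\cdots\frac{dx_n}{x_n},$$ where $\mathbb{T}^n=\{(x_1,\dots,x_n)\in\mathbb{C}^n : |x_1|=\cdots=|x_n|=1\}$. Here it is applied to polynomials in the $n=2$ variables $x,y$. *)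

theory Defs
  imports "HOL-Analysis.Analysis"
begin

text \<open>
  The integral of \<open>F(x\<^sub>1,\<dots>,x\<^sub>n) dx\<^sub>1 \<cdots> dx\<^sub>n\<close> over the torus \<open>|x\<^sub>1| = \<cdots> = |x\<^sub>n| = 1\<close>, each circle
  being traversed once counterclockwise: the pull-back along \<open>x\<^sub>j = exp (2 \<pi> i t\<^sub>j)\<close>, for which
  \<open>dx\<^sub>j = 2 \<pi> i x\<^sub>j dt\<^sub>j\<close>, is integrated over the unit cube with respect to Lebesgue measure.
\<close>

definition torus_point :: "real ^ 'n \<Rightarrow> complex ^ 'n" where
  "torus_point t = (\<chi> j. exp (2 * of_real pi * \<i> * of_real (t $ j)))"

definition torus_integral :: "(complex ^ 'n \<Rightarrow> complex) \<Rightarrow> complex" where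
  "torus_integral F =
     (LINT t : cbox 0 1 | lborel.
        F (torus_point t) * (\<Prod>j\<in>UNIV. 2 * of_real pi * \<i> * torus_point t $ j))"

text \<open>
  The logarithmic Mahler measure of the function \<open>P\<close> of \<open>n\<close> complex variables, intended for (the
  evaluation of) a non-zero rational function.  The zeros and poles of such a \<open>P\<close> on the torus form a
  null set, so the convention \<open>ln 0 = 0\<close> is immaterial.  The value is kept in the complex
  numbers, as in the defining formula; lemma \<open>mahler_measure_eq_real\<close> shows that it is real.
\<close>

definition mahler_measure :: "(complex ^ 'n \<Rightarrow> complex) \<Rightarrow> complex" where
  "mahler_measure P =
     1 / (2 * of_real pi * \<i>) ^ CARD('n) *
     torus_integral (\<lambda>x. of_real (ln (norm (P x))) * (\<Prod>j\<in>UNIV. 1 / x $ j))"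

lemma mahler_measure_eq_real:
  fixes P :: "complex ^ 'n \<Rightarrow> complex"
  shows "mahler_measure P =
    of_real (LINT t : cbox 0 1 | lborel. ln (norm (P (torus_point t))))"
proof -
  define c :: complex where "c = (2 * of_real pi * \<i>) ^ CARD('n)"
  have c0: "c \<noteq> 0" by (simp add: c_def)
  have eq: "of_real (ln (norm (P (torus_point t)))) * (\<Prod>j\<in>UNIV. 1 / torus_point t $ j) *
      (\<Prod>j\<in>UNIV. 2 * of_real pi * \<i> * torus_point t $ j)
      = c * of_real (ln (norm (P (torus_point t))))" for t :: "real ^ 'n"
  proof -
    have "(\<Prod>j\<in>UNIV. torus_point t $ j) \<noteq> 0"
      by (simp add: torus_point_def)
    then show ?thesis
      by (simp add: prod.distrib prod_dividef c_def)
  qed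
  have "torus_integral (\<lambda>x. of_real (ln (norm (P x))) * (\<Prod>j\<in>UNIV. 1 / x $ j))
      = c * of_real (LINT t : cbox 0 1 | lborel. ln (norm (P (torus_point t))))"
    unfolding torus_integral_def eq
    by (simp add: set_integral_complex_of_real)
  then show ?thesis
    using c0 by (simp add: mahler_measure_def c_def[symmetric])
qed

definition Q :: "real \<Rightarrow> complex \<Rightarrow> complex \<Rightarrow> complex" where
  "Q \<alpha> x y = (x^2 + x + 1) * y^2 + of_real \<alpha> * x * (x + 1) * y + x * (x^2 + x + 1)"

definition R :: "real \<Rightarrow> complex \<Rightarrow> complex \<Rightarrow> complex" where
  "R \<beta> x y = (x^2 + x + 1) * y^2
     + (x^4 + of_real \<beta> * x^3 + (2 * of_real \<beta> - 4) * x^2 + of_real \<beta> * x + 1) * y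
     + x^2 * (x^2 + x + 1)"

end

theory Submission
  imports Defs "HOL-Probability.Probability_Measure"
begin

text \<open>
  Put \<open>x = exp (2 \<pi> i t)\<close> and \<open>w = |1 + x|\<^sup>2\<close>. After a rotation of \<open>y\<close>, both polynomials have the modulus
  \<open>|2 A cos \<phi> + B|\<close> on the torus with \<open>A = w - 1\<close>, where \<open>B = \<alpha> sqrt w\<close> for \<open>Q\<close> and
  \<open>B = w\<^sup>2 + (\<alpha> - 2) w - 2\<close> for \<open>R\<close>, and Jensen's formula evaluates the mean over \<open>\<phi>\<close>. The
  derivatives of the two Mahler measures with respect to \<open>\<alpha>\<close> are then complete elliptic integrals in \<open>w\<close>,
  and a Moebius substitution carries one to the other, so the difference of the measures does not depend
  on \<open>\<alpha>\<close>. As \<open>\<alpha>\<close> tends to infinity this difference tends to the mean of \<open>- (ln w) / 2\<close>, which is zero.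

  To avoid differentiating under the integral sign, the increments of the Mahler measures are written as
  double integrals of nonnegative functions, to which Tonelli's theorem applies.
\<close>

section \<open>Periodic functions on the unit interval\<close>

text \<open>The mean over \<open>\<phi>\<close> has derivative \<open>1 / sqrt (B^2 - 4 A^2)\<close>
  in \<open>B\<close> when \<open>B > 2 |A|\<close>, and 0 when \<open>|B| < 2 |A|\<close>. It is
  unbounded at \<open>B = 2 |A|\<close>, and the points \<open>t\<close> where this happens move
  with \<open>\<alpha>\<close>: hence increments and Tonelli instead of a derivative. Tonelli needs
  one sign, that is, \<open>B \<ge> - 2 |A|\<close>. For \<open>Q\<close> this is clear because
  \<open>B \<ge> 0\<close>. For \<open>R\<close> one has
  \<open>B - 2 A = w (w + \<alpha> - 4)\<close> and \<open>B + 2 A = w^2 + \<alpha> w - 4\<close>;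
  the first is nonnegative exactly because \<open>\<alpha> \<ge> 4\<close>, and then the sign of the
  second alone decides where the derivative lives. With \<open>w\<close> as variable the two
  derivatives are periods of the genus one curves given by the cubic
  \<open>(4 - w) (\<alpha>^2 w - 4 (w - 1)^2)\<close> and the quartic
  \<open>(4 - w) (w + \<alpha> - 4) (w^2 + \<alpha> w - 4)\<close>. The cubic is also branched at
  infinity, so an isomorphism has to move infinity to a finite branch point; this is why a Moebius
  map appears.\<close>

abbreviation unit_lborel :: "real measure" where
  "unit_lborel \<equiv> restrict_space lborel {0..1}"

lemma prob_space_unit_lborel: "prob_space unit_lborel"
  by (rule prob_spaceI) (simp add: space_restrict_space emeasure_restrict_space)

interpretation unit: prob_space unit_lborel
  by (rule prob_space_unit_lborel)

lemma measurable_unit_lborel [measurable (raw)]: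
  "f \<in> borel_measurable borel \<Longrightarrow> f \<in> borel_measurable unit_lborel"
  by (rule measurable_restrict_space1) simp

lemma nn_integral_unit_lborel:
  assumes [measurable]: "f \<in> borel_measurable borel"
  shows "(\<integral>\<^sup>+t. f t \<partial>unit_lborel) = (\<integral>\<^sup>+t. f t * indicator {0..1} t \<partial>lborel)"
  by (subst nn_integral_restrict_space) simp_all

text \<open>Half-open intervals tile the line without overlap, so periods can be cut and translated
  exactly.\<close>

lemma nn_integral_unit_lborel_greaterThan:
  fixes f :: "real \<Rightarrow> ennreal"
  assumes [measurable]: "f \<in> borel_measurable borel"
  shows "(\<integral>\<^sup>+t. f t \<partial>unit_lborel) = (\<integral>\<^sup>+t. f t * indicator {0<..1} t \<partial>lborel)"
  unfolding nn_integral_unit_lborel[OF assms]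
  by (rule nn_integral_cong_AE)
    (use AE_lborel_singleton[of "0::real"] in \<open>auto split: split_indicator\<close>)

lemma integral_unit_lborel:
  fixes f :: "real \<Rightarrow> real"
  shows "integral\<^sup>L unit_lborel f = (\<integral>t. indicator {0..1} t * f t \<partial>lborel)"
  by (subst integral_restrict_space) simp_all

lemma periodic_of_nat:
  fixes h :: "real \<Rightarrow> 'a"
  assumes "\<And>t. h (t + 1) = h t"
  shows "h (t + real n) = h t"
proof (induction n)
  case (Suc n)
  have "h (t + real (Suc n)) = h ((t + real n) + 1)"
    by (simp add: algebra_simps)
  with Suc assms show ?case by simp
qed simp

lemma periodic_of_int:
  fixes h :: "real \<Rightarrow> 'a"
  assumes "\<And>t. h (t + 1) = h t"
  shows "h (t + of_int n) = h t"
proof (cases "n \<ge> 0")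
  case True
  with periodic_of_nat[of h t "nat n", OF assms] show ?thesis by simp
next
  case False
  with periodic_of_nat[of h "t + of_int n" "nat (- n)", OF assms] show ?thesis by simp
qed

text \<open>Periodicity reduces \<open>s\<close> to its fractional part \<open>r\<close>; the window
  from \<open>r\<close> to \<open>1 + r\<close> is then cut at 1 and its upper piece moved back by
  one period.\<close>

lemma nn_integral_periodic_shift:
  fixes h :: "real \<Rightarrow> ennreal"
  assumes [measurable]: "h \<in> borel_measurable borel" and per: "\<And>t. h (t + 1) = h t"
  shows "(\<integral>\<^sup>+t. h (t + s) \<partial>unit_lborel) = (\<integral>\<^sup>+t. h t \<partial>unit_lborel)"
proof -
  define r where "r = frac s"
  have r: "0 \<le> r" "r \<le> 1" by (simp_all add: r_def frac_lt_1 less_imp_le)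
  have "h (t + s) = h (t + r)" for t
    using periodic_of_int[of h "t + r" "floor s", OF per] by (simp add: r_def frac_def)
  then have "(\<integral>\<^sup>+t. h (t + s) \<partial>unit_lborel) = (\<integral>\<^sup>+t. h (t + r) * indicator {0<..1} t \<partial>lborel)"
    by (simp add: nn_integral_unit_lborel_greaterThan)
  also have "\<dots> = (\<integral>\<^sup>+t. h t * indicator {r<..1+r} t \<partial>lborel)"
    by (subst nn_integral_real_affine[of "\<lambda>t. h t * indicator {r<..1+r} t" 1 r])
      (auto intro!: nn_integral_cong split: split_indicator simp: add.commute)
  also have "\<dots> = (\<integral>\<^sup>+t. h t * indicator {r<..1} t + h t * indicator {1<..1+r} t \<partial>lborel)"
    using r by (intro nn_integral_cong) (auto split: split_indicator)
  also have "\<dots> = (\<integral>\<^sup>+t. h t * indicator {r<..1} t \<partial>lborel) + (\<integral>\<^sup>+t. h t * indicator {1<..1+r} t \<partial>lborel)"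
    by (rule nn_integral_add) simp_all
  also have "(\<integral>\<^sup>+t. h t * indicator {1<..1+r} t \<partial>lborel) = (\<integral>\<^sup>+t. h t * indicator {0<..r} t \<partial>lborel)"
    using per
    by (subst nn_integral_real_affine[of "\<lambda>t. h t * indicator {1<..1+r} t" 1 1])
      (auto intro!: nn_integral_cong split: split_indicator simp: add.commute)
  also have "(\<integral>\<^sup>+t. h t * indicator {r<..1} t \<partial>lborel) + \<dots> =
      (\<integral>\<^sup>+t. h t * indicator {r<..1} t + h t * indicator {0<..r} t \<partial>lborel)"
    by (rule nn_integral_add[symmetric]) simp_all
  also have "\<dots> = (\<integral>\<^sup>+t. h t * indicator {0<..1} t \<partial>lborel)"
    using r by (intro nn_integral_cong) (auto split: split_indicator)
  finally show ?thesis by (simp add: nn_integral_unit_lborel_greaterThan)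
qed

lemma nn_integral_periodic_double:
  fixes h :: "real \<Rightarrow> ennreal"
  assumes [measurable]: "h \<in> borel_measurable borel" and per: "\<And>t. h (t + 1) = h t"
  shows "(\<integral>\<^sup>+t. h (2 * t) \<partial>unit_lborel) = (\<integral>\<^sup>+t. h t \<partial>unit_lborel)"
proof -
  let ?I = "\<integral>\<^sup>+t. h t * indicator {0<..1} t \<partial>lborel"
  let ?D = "\<integral>\<^sup>+t. h (2 * t) * indicator {0<..1} t \<partial>lborel"
  have "2 * ?D = (\<integral>\<^sup>+t. h t * indicator {0<..2} t \<partial>lborel)"
    by (subst nn_integral_real_affine[of "\<lambda>t. h t * indicator {0<..2} t" 2 0])
      (auto intro!: nn_integral_cong arg_cong2[where f="(*)"] split: split_indicator)
  also have "\<dots> = (\<integral>\<^sup>+t. h t * indicator {0<..1} t + h t * indicator {1<..2} t \<partial>lborel)"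
    by (intro nn_integral_cong) (auto split: split_indicator)
  also have "\<dots> = ?I + (\<integral>\<^sup>+t. h t * indicator {1<..2} t \<partial>lborel)"
    by (rule nn_integral_add) simp_all
  also have "(\<integral>\<^sup>+t. h t * indicator {1<..2} t \<partial>lborel) = ?I"
    using per
    by (subst nn_integral_real_affine[of "\<lambda>t. h t * indicator {1<..2} t" 1 1])
      (auto intro!: nn_integral_cong split: split_indicator simp: add.commute)
  also have "?I + ?I = 2 * ?I" by (simp add: mult_2)
  finally have "?D = ?I" by (simp add: ennreal_mult_cancel_left)
  then show ?thesis by (simp add: nn_integral_unit_lborel_greaterThan)
qed

text \<open>Invariance is easy for nonnegative integrands. Applied to indicators it shows that two
  functions have the same law, and this carries integrability and integral over to signed functions
  such as logarithms without splitting them by sign.\<close>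

lemma distr_cong_nn_integral:
  fixes f g :: "'a \<Rightarrow> real"
  assumes [measurable]: "f \<in> borel_measurable M" "g \<in> borel_measurable M"
    and eq: "\<And>A. A \<in> sets borel \<Longrightarrow> (\<integral>\<^sup>+t. indicator A (f t) \<partial>M) = (\<integral>\<^sup>+t. indicator A (g t) \<partial>M)"
  shows "distr M borel f = distr M borel g"
proof (rule measure_eqI)
  fix A assume "A \<in> sets (distr M borel f)"
  then have A [measurable]: "A \<in> sets borel" by simp
  have "emeasure (distr M borel k) A = (\<integral>\<^sup>+t. indicator A (k t) \<partial>M)"
    if [measurable]: "k \<in> borel_measurable M" for k
  proof -
    have "emeasure (distr M borel k) A = (\<integral>\<^sup>+x. indicator A x \<partial>distr M borel k)"
      by simp
    also have "\<dots> = (\<integral>\<^sup>+t. indicator A (k t) \<partial>M)"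
      by (rule nn_integral_distr) simp_all
    finally show ?thesis .
  qed
  with eq[OF A] show "emeasure (distr M borel f) A = emeasure (distr M borel g) A"
    by simp
qed simp

lemma distr_periodic_shift:
  fixes h :: "real \<Rightarrow> real"
  assumes [measurable]: "h \<in> borel_measurable borel" and per: "\<And>t. h (t + 1) = h t"
  shows "distr unit_lborel borel (\<lambda>t. h (t + s)) = distr unit_lborel borel h"
proof (rule distr_cong_nn_integral)
  fix A :: "real set" assume [measurable]: "A \<in> sets borel"
  show "(\<integral>\<^sup>+t. indicator A (h (t + s)) \<partial>unit_lborel) = (\<integral>\<^sup>+t. indicator A (h t) \<partial>unit_lborel)"
    by (rule nn_integral_periodic_shift[of "\<lambda>t. indicator A (h t)"]) (simp_all add: per)
qed simp_all

lemma distr_periodic_double: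
  fixes h :: "real \<Rightarrow> real"
  assumes [measurable]: "h \<in> borel_measurable borel" and per: "\<And>t. h (t + 1) = h t"
  shows "distr unit_lborel borel (\<lambda>t. h (2 * t)) = distr unit_lborel borel h"
proof (rule distr_cong_nn_integral)
  fix A :: "real set" assume [measurable]: "A \<in> sets borel"
  show "(\<integral>\<^sup>+t. indicator A (h (2 * t)) \<partial>unit_lborel) = (\<integral>\<^sup>+t. indicator A (h t) \<partial>unit_lborel)"
    by (rule nn_integral_periodic_double[of "\<lambda>t. indicator A (h t)"]) (simp_all add: per)
qed simp_all

lemma integrable_integral_distr_cong:
  fixes f g :: "'a \<Rightarrow> real"
  assumes "distr M borel f = distr M borel g"
    and [measurable]: "f \<in> borel_measurable M" "g \<in> borel_measurable M"
  shows "integrable M f \<longleftrightarrow> integrable M g" "integral\<^sup>L M f = integral\<^sup>L M g"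
  using integrable_distr_eq[of f M borel "\<lambda>x. x :: real"] integrable_distr_eq[of g M borel "\<lambda>x. x :: real"]
    integral_distr[of f M borel "\<lambda>x. x :: real"] integral_distr[of g M borel "\<lambda>x. x :: real"] assms
  by simp_all

lemma has_bochner_integral_periodic_shift:
  fixes h :: "real \<Rightarrow> real"
  assumes [measurable]: "h \<in> borel_measurable borel" and per: "\<And>t. h (t + 1) = h t"
  shows "has_bochner_integral unit_lborel (\<lambda>t. h (t + s)) x \<longleftrightarrow> has_bochner_integral unit_lborel h x"
  unfolding has_bochner_integral_iff
  using integrable_integral_distr_cong[where f = "\<lambda>t. h (t + s)" and g = h, OF distr_periodic_shift[OF assms]] by simp

lemma has_bochner_integral_periodic_double:
  fixes h :: "real \<Rightarrow> real"
  assumes [measurable]: "h \<in> borel_measurable borel" and per: "\<And>t. h (t + 1) = h t"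
  shows "has_bochner_integral unit_lborel (\<lambda>t. h (2 * t)) x \<longleftrightarrow> has_bochner_integral unit_lborel h x"
  unfolding has_bochner_integral_iff
  using integrable_integral_distr_cong[where f = "\<lambda>t. h (2 * t)" and g = h, OF distr_periodic_double[OF assms]] by simp

section \<open>Jensen's formula\<close>

lemma countable_cis_eq: "countable {s. p * cis (2 * pi * (s + \<sigma>)) = 1}" (is "countable ?S")
proof (cases "?S = {}")
  case False
  then obtain s0 where s0: "p * cis (2 * pi * (s0 + \<sigma>)) = 1" by auto
  have "?S \<subseteq> range (\<lambda>n::int. s0 + of_int n)"
  proof
    fix s assume "s \<in> ?S"
    with s0 have "cis (2 * pi * (s + \<sigma>)) = cis (2 * pi * (s0 + \<sigma>))"
      by (metis (mono_tags, lifting) mem_Collect_eq mult_cancel_left mult_zero_left zero_neq_one)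
    moreover have "cis (2 * pi * (s - s0)) = cis (2 * pi * (s + \<sigma>)) / cis (2 * pi * (s0 + \<sigma>))"
      by (simp add: cis_divide algebra_simps)
    ultimately have "cis (2 * pi * (s - s0)) = 1" by simp
    then have "cos (2 * pi * (s - s0)) = 1"
      by (simp add: complex_eq_iff)
    then obtain n :: int where "2 * pi * (s - s0) = of_int n * 2 * pi"
      using cos_one_2pi_int by blast
    then have "s = s0 + of_int n" by simp
    then show "s \<in> range (\<lambda>n::int. s0 + of_int n)" by blast
  qed
  then show ?thesis by (rule countable_subset) simp
qed simp

lemma AE_unit_lborel_lborel: "AE s in lborel. P s \<Longrightarrow> AE s in unit_lborel. P s"
  by (subst AE_restrict_space_iff) auto

text \<open>Because \<open>ln 0 = 0\<close>, the logarithm of a product splits only where all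
  factors are nonzero; the exceptional \<open>s\<close> lie in one coset of the integers.\<close>

lemma AE_one_minus_cis_nonzero: "AE s in unit_lborel. 1 - p * cis (2 * pi * (s + \<sigma>)) \<noteq> 0"
proof (rule AE_unit_lborel_lborel)
  have "{s. p * cis (2 * pi * (s + \<sigma>)) = 1} \<in> null_sets lborel"
    by (rule countable_imp_null_set_lborel[OF countable_cis_eq])
  then show "AE s in lborel. 1 - p * cis (2 * pi * (s + \<sigma>)) \<noteq> 0"
    by (rule AE_I') auto
qed

lemma integrable_unit_lborel_reflect:
  assumes [measurable]: "f \<in> borel_measurable borel" and "integrable unit_lborel f"
  shows "integrable unit_lborel (\<lambda>t. f (1 - t) :: real)"
proof -
  have "integrable lborel (\<lambda>t. indicator {0..1} t *\<^sub>R f t)"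
    using assms(2) by (subst (asm) integrable_restrict_space) (simp_all add: set_integrable_def)
  from lborel_integrable_real_affine[OF this, of "-1" 1]
  have "integrable lborel (\<lambda>t. indicator {0..1} (1 - t) *\<^sub>R f (1 - t))" by simp
  also have "(\<lambda>t. indicator {0..1} (1 - t) *\<^sub>R f (1 - t)) = (\<lambda>t. indicator {0..1} t *\<^sub>R f (1 - t))"
    by (auto simp: fun_eq_iff split: split_indicator)
  finally show ?thesis
    by (subst integrable_restrict_space) (simp_all add: set_integrable_def)
qed

lemma integrable_powr_unit_lborel:
  assumes "a > -1"
  shows "integrable unit_lborel (\<lambda>t. t powr a)"
proof -
  have "(\<lambda>t. t powr a) absolutely_integrable_on {0..1}"
    by (rule nonnegative_absolutely_integrable_1)
      (use assms in \<open>auto intro: integrable_on_powr_from_0\<close>)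
  then have "integrable lebesgue (\<lambda>t. indicator {0..1} t *\<^sub>R t powr a)"
    by (simp add: set_integrable_def)
  then have "integrable lborel (\<lambda>t. indicator {0..1} t *\<^sub>R t powr a)"
    by (subst (asm) integrable_completion) simp_all
  then show ?thesis
    by (subst integrable_restrict_space) (simp_all add: set_integrable_def)
qed

lemma sin_pi_ge:
  assumes "0 \<le> t" "t \<le> 1 / 2"
  shows "sin (pi * t) \<ge> t"
proof -
  have pi: "3 \<le> pi" "pi \<le> 16/5" using pi_approx by simp_all
  define x where "x = pi * t"
  have x: "0 \<le> x" "x \<le> 8/5"
    using assms pi mult_mono[of pi "16/5" t "1/2"] by (auto simp: x_def)
  have "\<bar>sin x - (\<Sum>m<3. sin_coeff m * x ^ m)\<bar> \<le> inverse (fact 3) * \<bar>x\<bar> ^ 3"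
    by (rule Maclaurin_sin_bound)
  moreover have "(\<Sum>m<3. sin_coeff m * x ^ m) = x"
    by (simp add: eval_nat_numeral sin_coeff_def)
  ultimately have "\<bar>sin x - x\<bar> \<le> x ^ 3 / 6"
    using x by (simp add: fact_numeral)
  then have "x - x ^ 3 / 6 \<le> sin x" by linarith
  \<comment> \<open>Here \<open>x^2 / 6 \<le> 64/150 < 1/2\<close>, so the Taylor bound leaves
    \<open>sin x \<ge> x / 2\<close>, and \<open>x = pi * t \<ge> 3 * t\<close>.\<close>
  moreover have "x * x \<le> (8/5) * (8/5)" using x by (intro mult_mono) auto
  then have "x * (x * x) \<le> x * (64/25)" using x by (intro mult_left_mono) auto
  then have "x ^ 3 \<le> 64/25 * x" by (simp add: power3_eq_cube mult.assoc)
  ultimately have "x / 2 \<le> sin x" using x by linarith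
  moreover have "3 * t \<le> x" unfolding x_def using assms pi by (intro mult_right_mono) auto
  ultimately show ?thesis using assms by (simp add: x_def)
qed

lemma norm_one_minus_cis: "norm (1 - cis (2 * pi * t)) = 2 * \<bar>sin (pi * t)\<bar>"
proof -
  have "(norm (1 - cis (2 * pi * t)))\<^sup>2 = 2 - 2 * cos (2 * (pi * t))"
    using sin_cos_squared_add[of "2 * (pi * t)"]
    by (simp add: cmod_power2 power2_diff mult.assoc)
  also have "\<dots> = (2 * \<bar>sin (pi * t)\<bar>)\<^sup>2"
    by (simp add: cos_double_sin power_mult_distrib)
  finally have "(norm (1 - cis (2 * pi * t)))\<^sup>2 = (2 * \<bar>sin (pi * t)\<bar>)\<^sup>2" .
  then show ?thesis by (rule power2_eq_imp_eq) simp_all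
qed

text \<open>Apply \<open>ln u \<le> u - 1\<close> to \<open>u = t powr -(1/2)\<close>. The exponent
  exceeds -1, so the bound is integrable at 0.\<close>

lemma neg_ln_le_powr: "0 < t \<Longrightarrow> - ln t \<le> 2 * t powr -(1/2)" for t :: real
proof -
  assume t: "0 < t"
  have "ln (t powr -(1/2)) \<le> t powr -(1/2)"
    using t by (intro order.trans[OF ln_le_minus_one]) auto
  then show ?thesis using t by (simp add: ln_powr)
qed

lemma integrable_ln_one_minus_cis:
  "integrable unit_lborel (\<lambda>t. ln (norm (1 - cis (2 * pi * t))))"
proof (rule Bochner_Integration.integrable_bound)
  \<comment> \<open>One power for each end of the period, where \<open>1 - z\<close> vanishes; the
    constant 1 covers the positive part, at most \<open>ln 2\<close>.\<close>
  let ?g = "\<lambda>t::real. 1 + 2 * t powr -(1/2) + 2 * (1 - t) powr -(1/2)"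
  show "integrable unit_lborel ?g"
    using integrable_unit_lborel_reflect[OF _ integrable_powr_unit_lborel[of "-1/2"]]
      integrable_powr_unit_lborel[of "-1/2"]
    by (intro Bochner_Integration.integrable_add integrable_mult_right) auto
  show "(\<lambda>t. ln (norm (1 - cis (2 * pi * t)))) \<in> borel_measurable unit_lborel"
    unfolding norm_one_minus_cis by measurable
  have bound: "norm (ln (norm (1 - cis (2 * pi * t)))) \<le> norm (?g t)" if t: "0 < t" "t < 1" for t
  proof -
    let ?s = "sin (pi * t)"
    have g: "- ln t \<le> 2 * t powr -(1/2)" "- ln (1 - t) \<le> 2 * (1 - t) powr -(1/2)"
      "0 \<le> - ln t" "0 \<le> - ln (1 - t)"
      using t by (auto intro: neg_ln_le_powr)
    have "min t (1 - t) \<le> ?s"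
    proof (cases "t \<le> 1 / 2")
      case True
      with t sin_pi_ge[of t] show ?thesis by simp
    next
      case False
      with t sin_pi_ge[of "1 - t"] show ?thesis
        by (simp add: right_diff_distrib)
    qed
    then have s: "0 < ?s" "min t (1 - t) \<le> ?s" using t by auto
    have "ln (min t (1 - t)) \<le> ln (2 * ?s)" using s t by (intro ln_mono) auto
    moreover have "ln (min t (1 - t)) \<ge> ln t + ln (1 - t)"
      using g by (auto simp: min_def)
    moreover have "ln (2 * ?s) \<le> ln 2" using s by (intro ln_mono) auto
    moreover have "ln 2 \<le> (1::real)" using ln_le_minus_one[of "2::real"] by simp
    ultimately have "\<bar>ln (2 * ?s)\<bar> \<le> ?g t"
      using g unfolding abs_le_iff by linarith
    also have "\<dots> \<le> norm (?g t)" by simp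
    finally show ?thesis using s by (simp add: norm_one_minus_cis)
  qed
  show "AE t in unit_lborel. norm (ln (norm (1 - cis (2 * pi * t)))) \<le> norm (?g t)"
  proof (subst AE_restrict_space_iff)
    show "AE t in lborel. t \<in> {0..1} \<longrightarrow> norm (ln (norm (1 - cis (2 * pi * t)))) \<le> norm (?g t)"
      using AE_lborel_singleton[of "0::real"] AE_lborel_singleton[of "1::real"]
    proof eventually_elim
      case (elim t)
      then show ?case using bound[of t] by auto
    qed
  qed simp
qed

lemma borel_measurable_norm_one_minus_cis [measurable]:
  "(\<lambda>t. norm (1 - p * cis (2 * pi * t))) \<in> borel_measurable borel"
  by (intro borel_measurable_continuous_onI continuous_intros)

text \<open>
  Writing \<open>I p\<close> for the mean of \<open>ln |1 - p z|\<close> over the unit circle, \<open>I p = I (- p)\<close> and the invariance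
  of the mean under \<open>z \<mapsto> z\<^sup>2\<close> give \<open>I (p\<^sup>2) = 2 I p\<close>. Hence \<open>I 1 = 0\<close>, and \<open>I p = 0\<close> for \<open>|p| < 1\<close> because
  \<open>I (p ^ 2 ^ n) = 2 ^ n I p\<close> is bounded in \<open>n\<close>.
\<close>

lemma integral_ln_norm_double:
  assumes int: "integrable unit_lborel (\<lambda>t. ln (norm (1 - p * cis (2 * pi * t))))"
  shows "(\<integral>t. ln (norm (1 - p\<^sup>2 * cis (2 * pi * t))) \<partial>unit_lborel) =
    2 * (\<integral>t. ln (norm (1 - p * cis (2 * pi * t))) \<partial>unit_lborel)"
proof -
  define L where "L q t = ln (norm (1 - q * cis (2 * pi * t)))" for q t
  have [measurable]: "L q \<in> borel_measurable borel" for q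
    unfolding L_def by measurable
  have per: "L q (t + 1) = L q t" for q t
    by (simp add: L_def distrib_left flip: cis_mult)
  have I: "has_bochner_integral unit_lborel (L p) (integral\<^sup>L unit_lborel (L p))"
    using int by (simp add: has_bochner_integral_iff L_def[abs_def])
  have "has_bochner_integral unit_lborel (\<lambda>t. L p t + L p (t + 1/2))
    (integral\<^sup>L unit_lborel (L p) + integral\<^sup>L unit_lborel (L p))"
    using I by (intro has_bochner_integral_add) (simp_all add: has_bochner_integral_periodic_shift per)
  moreover have "AE t in unit_lborel. L p t + L p (t + 1/2) = L (p\<^sup>2) (2 * t)"
    using AE_one_minus_cis_nonzero[of p 0] AE_one_minus_cis_nonzero[of p "1/2"]
  proof eventually_elim
    case (elim t)
    let ?z = "cis (2 * pi * t)"
    have half: "cis (2 * pi * (t + 1/2)) = - ?z"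
      by (simp add: distrib_left flip: cis_mult)
    have "cis (2 * pi * (2 * t)) = ?z\<^sup>2"
      by (simp add: power2_eq_square cis_mult algebra_simps)
    then have "1 - p\<^sup>2 * cis (2 * pi * (2 * t)) = (1 - p * ?z) * (1 - p * cis (2 * pi * (t + 1/2)))"
      unfolding half by (simp add: power2_eq_square algebra_simps)
    with elim show ?case
      by (simp add: L_def norm_mult ln_mult)
  qed
  ultimately have "has_bochner_integral unit_lborel (\<lambda>t. L (p\<^sup>2) (2 * t))
    (integral\<^sup>L unit_lborel (L p) + integral\<^sup>L unit_lborel (L p))"
    by (subst has_bochner_integral_cong_AE[symmetric]) simp_all
  then have "has_bochner_integral unit_lborel (L (p\<^sup>2))
    (integral\<^sup>L unit_lborel (L p) + integral\<^sup>L unit_lborel (L p))"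
    by (simp add: has_bochner_integral_periodic_double per)
  then show ?thesis
    by (simp add: has_bochner_integral_integral_eq L_def[abs_def])
qed

lemma ln_norm_one_minus_bound:
  fixes p z :: complex
  assumes "norm p \<le> \<rho>" "\<rho> < 1" "norm z = 1"
  shows "\<bar>ln (norm (1 - p * z))\<bar> \<le> - ln (1 - \<rho>)"
proof -
  have pz: "norm (p * z) \<le> \<rho>" using assms by (simp add: norm_mult)
  have \<rho>: "0 \<le> \<rho>" using assms norm_ge_zero[of p] by linarith
  have lo: "1 - \<rho> \<le> norm (1 - p * z)"
    using norm_triangle_ineq2[of 1 "p * z"] pz by simp
  have hi: "norm (1 - p * z) \<le> 1 + \<rho>"
    using norm_triangle_ineq4[of 1 "p * z"] pz by simp
  have "ln (1 - \<rho>) \<le> ln (norm (1 - p * z))"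
    using lo assms by (intro ln_mono) auto
  moreover have "ln (norm (1 - p * z)) \<le> ln (1 + \<rho>)"
    using hi lo assms by (intro ln_mono) auto
  \<comment> \<open>The lower end of the range is the larger one in absolute value.\<close>
  moreover have "ln (1 + \<rho>) + ln (1 - \<rho>) \<le> 0"
    using assms \<rho> ln_le_minus_one[of "1 + \<rho>"] ln_le_minus_one[of "1 - \<rho>"] by linarith
  ultimately show ?thesis by linarith
qed

lemma has_bochner_integral_ln_norm_one_minus_interior:
  assumes "norm p < 1"
  shows "has_bochner_integral unit_lborel (\<lambda>t. ln (norm (1 - p * cis (2 * pi * t)))) 0"
proof -
  define I where "I q = (\<integral>t. ln (norm (1 - q * cis (2 * pi * t))) \<partial>unit_lborel)" for q
  define C where "C = - ln (1 - norm p)"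
  have int: "integrable unit_lborel (\<lambda>t. ln (norm (1 - q * cis (2 * pi * t))))"
    and bound: "\<bar>I q\<bar> \<le> C" if "norm q \<le> norm p" for q
  proof -
    have b: "norm (ln (norm (1 - q * cis (2 * pi * t)))) \<le> C" for t
      using ln_norm_one_minus_bound[OF that assms, of "cis (2 * pi * t)"] by (simp add: C_def)
    then show int: "integrable unit_lborel (\<lambda>t. ln (norm (1 - q * cis (2 * pi * t))))"
      by (intro unit.integrable_const_bound) auto
    have "norm (I q) \<le> (\<integral>t. norm (ln (norm (1 - q * cis (2 * pi * t)))) \<partial>unit_lborel)"
      unfolding I_def by (rule integral_norm_bound)
    also have "\<dots> \<le> (\<integral>t. C \<partial>unit_lborel)"
      using int b by (intro integral_mono integrable_norm) simp_all
    finally show "\<bar>I q\<bar> \<le> C" by (simp add: unit.prob_space[simplified])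
  qed
  \<comment> \<open>The norm bound travels with the induction so that integrability and the single
    constant \<open>C\<close> serve every iterate.\<close>
  have iter: "norm (p ^ 2 ^ n) \<le> norm p \<and> I (p ^ 2 ^ n) = 2 ^ n * I p" for n
  proof (induction n)
    case (Suc n)
    have eq: "p ^ 2 ^ Suc n = (p ^ 2 ^ n)\<^sup>2"
      by (metis power_Suc2 power_mult)
    have "norm (p ^ 2 ^ n) * norm (p ^ 2 ^ n) \<le> norm (p ^ 2 ^ n) * 1"
      using Suc assms by (intro mult_left_mono) auto
    moreover have "I ((p ^ 2 ^ n)\<^sup>2) = 2 * I (p ^ 2 ^ n)"
      unfolding I_def using Suc by (intro integral_ln_norm_double int) auto
    ultimately show ?case using Suc unfolding eq by (simp add: power2_eq_square norm_mult)
  qed simp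
  have "\<bar>I p\<bar> \<le> C * (1/2) ^ n" for n
    using bound[of "p ^ 2 ^ n"] iter[of n] by (simp add: abs_mult field_simps)
  moreover have "(\<lambda>n. C * (1/2) ^ n) \<longlonglongrightarrow> C * 0"
    by (intro tendsto_intros) simp
  ultimately have "\<bar>I p\<bar> \<le> 0"
    by (intro LIMSEQ_le_const[of _ "0::real"]) auto
  then show ?thesis
    using int[of p] by (simp add: has_bochner_integral_iff I_def)
qed

lemma has_bochner_integral_ln_norm_one_minus:
  assumes "norm p \<le> 1"
  shows "has_bochner_integral unit_lborel (\<lambda>t. ln (norm (1 - p * cis (2 * pi * (t + \<sigma>))))) 0"
proof -
  define L where "L q t = ln (norm (1 - q * cis (2 * pi * t)))" for q t
  have [measurable]: "L q \<in> borel_measurable borel" for q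
    unfolding L_def by measurable
  have per: "L q (t + 1) = L q t" for q t
    by (simp add: L_def distrib_left flip: cis_mult)
  have "has_bochner_integral unit_lborel (L p) 0"
  proof (cases "norm p = 1")
    case True
    then obtain \<theta> where \<theta>: "p = cis \<theta>"
      by (metis complex_norm_eq_1_exp cis_conv_exp)
    have one: "has_bochner_integral unit_lborel (L 1) 0"
      using integral_ln_norm_double[of 1] integrable_ln_one_minus_cis
      by (simp add: has_bochner_integral_iff L_def[abs_def])
    \<comment> \<open>A unimodular \<open>p\<close> is a rotation of 1, where the doubling formula
      reads \<open>I = 2 * I\<close> with \<open>I\<close> finite.\<close>
    have "L 1 (t + \<theta> / (2 * pi)) = L p t" for t
      by (simp add: L_def \<theta> cis_mult distrib_left add.commute)
    with one show ?thesis
      using has_bochner_integral_periodic_shift[of "L 1" "\<theta> / (2 * pi)" 0] by (simp add: per)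
  next
    case False
    with assms show ?thesis
      unfolding L_def by (intro has_bochner_integral_ln_norm_one_minus_interior) simp
  qed
  then have "has_bochner_integral unit_lborel (\<lambda>t. L p (t + \<sigma>)) 0"
    by (simp add: has_bochner_integral_periodic_shift per)
  then show ?thesis by (simp add: L_def)
qed

text \<open>
  The mean of \<open>ln |2 A cos \<phi> + B|\<close> over \<open>\<phi>\<close>. The square root of a negative number is negative here, so the
  maximum is \<open>|A|\<close> when \<open>|B| \<le> 2 |A|\<close>.
\<close>

definition jensen :: "real \<Rightarrow> real \<Rightarrow> real" where
  "jensen A B = ln (max \<bar>A\<bar> ((\<bar>B\<bar> + sqrt (B\<^sup>2 - 4 * A\<^sup>2)) / 2))"

text \<open>On the circle \<open>2 * A * Re z + B\<close> is
  \<open>A * (z^2 + (B / A) * z + 1)\<close> up to a unimodular factor. The discriminant is not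
  positive, so the roots are conjugate of modulus 1 and only \<open>|A|\<close> is left as
  constant.\<close>

lemma quadratic_torus_factorization_elliptic:
  fixes A B :: real
  assumes "A \<noteq> 0" "\<bar>B\<bar> \<le> 2 * \<bar>A\<bar>"
  shows "\<exists>p q. norm p \<le> 1 \<and> norm q \<le> 1 \<and>
    (\<forall>z. norm z = 1 \<longrightarrow> \<bar>2 * A * Re z + B\<bar> = \<bar>A\<bar> * (norm (1 - p * z) * norm (1 - q * z)))"
proof -
  define b where "b = - B / (2 * A)"
  have "\<bar>b\<bar> \<le> 1" using assms by (simp add: b_def abs_mult)
  then have b2: "b\<^sup>2 \<le> 1" by (simp add: abs_square_le_1)
  define p where "p = Complex b (sqrt (1 - b\<^sup>2))"
  have np: "norm p = 1" using b2 by (simp add: p_def complex_norm)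
  have pp: "p * cnj p = 1" using complex_norm_square[of p] np by simp
  have ps: "p + cnj p = of_real (2 * b)" by (simp add: p_def complex_eq_iff)
  have "\<bar>2 * A * Re z + B\<bar> = \<bar>A\<bar> * (norm (1 - p * z) * norm (1 - cnj p * z))" if z: "norm z = 1" for z
  proof -
    have zz: "z * cnj z = 1" using complex_norm_square[of z] z by simp
    have "(1 - p * z) * (1 - cnj p * z) = 1 - (p + cnj p) * z + (p * cnj p) * z\<^sup>2"
      by (simp add: algebra_simps power2_eq_square)
    also have "\<dots> = z * cnj z - of_real (2 * b) * z + z\<^sup>2"
      by (simp add: pp ps zz)
    also have "\<dots> = z * ((z + cnj z) - of_real (2 * b))"
      by (simp add: algebra_simps power2_eq_square)
    also have "\<dots> = z * of_real (2 * Re z - 2 * b)"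
      by (simp add: complex_add_cnj)
    finally have "norm (1 - p * z) * norm (1 - cnj p * z) = \<bar>2 * Re z - 2 * b\<bar>"
      by (metis norm_mult z mult_1 norm_of_real)
    moreover have "2 * A * Re z + B = A * (2 * Re z - 2 * b)"
      using assms by (simp add: b_def field_simps)
    ultimately show ?thesis by (simp add: abs_mult)
  qed
  with np show ?thesis by (intro exI[of _ p] exI[of _ "cnj p"]) simp
qed

text \<open>Comparing coefficients in \<open>K * |1 - p z|^2 = sgn B * (2 * A * Re z + B)\<close>
  for real \<open>p\<close> gives \<open>K * (1 + p^2) = |B|\<close> and
  \<open>K * p = - A * sgn B\<close>. Hence \<open>K\<close> is a root of
  \<open>X^2 - |B| X + A^2\<close>, and the larger root is the one with \<open>|p| \<le> 1\<close>.
  Both factors may be equal because inverse roots are at proportional distances from points of the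
  circle.\<close>

lemma quadratic_torus_factorization_hyperbolic:
  fixes A B :: real
  assumes "2 * \<bar>A\<bar> < \<bar>B\<bar>"
  defines "K \<equiv> (\<bar>B\<bar> + sqrt (B\<^sup>2 - 4 * A\<^sup>2)) / 2"
  shows "\<exists>p q. norm p \<le> 1 \<and> norm q \<le> 1 \<and>
    (\<forall>z. norm z = 1 \<longrightarrow> \<bar>2 * A * Re z + B\<bar> = K * (norm (1 - p * z) * norm (1 - q * z)))"
proof -
  have AB: "4 * A\<^sup>2 \<le> B\<^sup>2"
    using power_mono[of "2 * \<bar>A\<bar>" "\<bar>B\<bar>" 2] assms by (simp add: power_mult_distrib)
  define r where "r = sqrt (B\<^sup>2 - 4 * A\<^sup>2)"
  have "0 \<le> r" using AB by (simp add: r_def)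
  moreover have "a < (b + r) / 2 \<and> 0 < (b + r) / 2" if "2 * a < b" "0 \<le> r" "0 \<le> a" for a b :: real
    using that by (simp add: field_simps)
  ultimately have "\<bar>A\<bar> < K \<and> 0 < K" using assms(1) unfolding K_def r_def[symmetric] by simp
  then have K: "\<bar>A\<bar> < K" "0 < K" by simp_all
  have "K * K - \<bar>B\<bar> * K + A\<^sup>2 = 0"
    using AB by (simp add: K_def field_simps power2_eq_square)
  then have KB: "\<bar>B\<bar> * K = K * K + A\<^sup>2" by simp
  define p where "p = - A * sgn B / K"
  have B0: "B \<noteq> 0" using assms by auto
  have p2: "p\<^sup>2 = A\<^sup>2 / K\<^sup>2" using B0 by (simp add: p_def power_mult_distrib power_divide sgn_if)
  have pK: "\<bar>p\<bar> \<le> 1" using K B0 by (simp add: p_def abs_mult)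
  have "\<bar>2 * A * Re z + B\<bar> = K * (norm (1 - of_real p * z) * norm (1 - of_real p * z))"
    if z: "norm z = 1" for z
  proof -
    have "(norm (1 - of_real p * z))\<^sup>2 = 1 - 2 * p * Re z + p\<^sup>2 * ((Re z)\<^sup>2 + (Im z)\<^sup>2)"
      unfolding cmod_power2 by (simp add: power2_eq_square algebra_simps)
    also have "(Re z)\<^sup>2 + (Im z)\<^sup>2 = 1" using z cmod_power2[of z] by simp
    finally have "K * (norm (1 - of_real p * z))\<^sup>2 = K * (1 - 2 * p * Re z + p\<^sup>2)" by simp
    also have "\<dots> = (K * K + A\<^sup>2) / K + 2 * A * sgn B * Re z"
      using K B0 by (simp add: p2 p_def field_simps power2_eq_square)
    also have "\<dots> = sgn B * (2 * A * Re z + B)"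
      using K by (simp flip: KB add: algebra_simps abs_sgn)
    finally have eq: "K * (norm (1 - of_real p * z))\<^sup>2 = sgn B * (2 * A * Re z + B)" .
    have "0 \<le> K * (norm (1 - of_real p * z))\<^sup>2" using K by simp
    then have "K * (norm (1 - of_real p * z))\<^sup>2 = \<bar>sgn B * (2 * A * Re z + B)\<bar>"
      unfolding eq by simp
    also have "\<dots> = \<bar>2 * A * Re z + B\<bar>" using B0 by (simp add: abs_mult)
    finally show ?thesis by (simp add: power2_eq_square)
  qed
  with pK show ?thesis
    by (intro exI[of _ "of_real p :: complex"]) simp
qed

lemma quadratic_torus_factorization:
  fixes A B :: real
  assumes "A \<noteq> 0 \<or> B \<noteq> 0"
  defines "K \<equiv> max \<bar>A\<bar> ((\<bar>B\<bar> + sqrt (B\<^sup>2 - 4 * A\<^sup>2)) / 2)"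
  shows "\<exists>p q. norm p \<le> 1 \<and> norm q \<le> 1 \<and>
    (\<forall>z. norm z = 1 \<longrightarrow> \<bar>2 * A * Re z + B\<bar> = K * (norm (1 - p * z) * norm (1 - q * z)))"
proof (cases "\<bar>B\<bar> \<le> 2 * \<bar>A\<bar>")
  case True
  then have "B\<^sup>2 \<le> 4 * A\<^sup>2"
    using power_mono[of "\<bar>B\<bar>" "2 * \<bar>A\<bar>" 2] by (simp add: power_mult_distrib)
  then have "sqrt (B\<^sup>2 - 4 * A\<^sup>2) \<le> 0" by simp
  from add_mono[OF True this] have "K = \<bar>A\<bar>" unfolding K_def by (intro max_absorb1) simp
  moreover have "A \<noteq> 0" using True assms by auto
  ultimately show ?thesis using quadratic_torus_factorization_elliptic[OF _ True] by simp
next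
  case False
  then have "4 * A\<^sup>2 \<le> B\<^sup>2"
    using power_mono[of "2 * \<bar>A\<bar>" "\<bar>B\<bar>" 2] by (simp add: power_mult_distrib)
  moreover define r where "r = sqrt (B\<^sup>2 - 4 * A\<^sup>2)"
  ultimately have "0 \<le> r" by simp
  moreover have "a \<le> (b + r) / 2" if "\<not> b \<le> 2 * a" "0 \<le> r" for a b :: real
    using that by (simp add: field_simps)
  ultimately have "K = (\<bar>B\<bar> + r) / 2"
    using False unfolding K_def r_def[symmetric] by (intro max_absorb2) blast
  then have Keq: "K = (\<bar>B\<bar> + sqrt (B\<^sup>2 - 4 * A\<^sup>2)) / 2" by (simp add: r_def)
  show ?thesis
    unfolding Keq using quadratic_torus_factorization_hyperbolic[of A B] False by (simp only: not_le)
qed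

lemma jensen_argument_pos:
  assumes "A \<noteq> 0 \<or> B \<noteq> 0"
  shows "0 < max \<bar>A\<bar> ((\<bar>B\<bar> + sqrt (B\<^sup>2 - 4 * A\<^sup>2)) / 2)"
  using assms by (cases "A = 0") (auto simp: less_max_iff_disj)

lemma has_bochner_integral_jensen:
  "has_bochner_integral unit_lborel
     (\<lambda>s. ln \<bar>2 * A * cos (2 * pi * (s + \<sigma>)) + B\<bar>) (jensen A B)"
proof (cases "A \<noteq> 0 \<or> B \<noteq> 0")
  case True
  define K where "K = max \<bar>A\<bar> ((\<bar>B\<bar> + sqrt (B\<^sup>2 - 4 * A\<^sup>2)) / 2)"
  have K: "0 < K" using jensen_argument_pos[OF True] by (simp add: K_def)
  obtain p q where pq: "norm p \<le> 1" "norm q \<le> 1"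
    and fac: "\<And>z. norm z = 1 \<Longrightarrow> \<bar>2 * A * Re z + B\<bar> = K * (norm (1 - p * z) * norm (1 - q * z))"
    using quadratic_torus_factorization[OF True] unfolding K_def by blast
  have "has_bochner_integral unit_lborel (\<lambda>s. ln K) (ln K)"
    by (simp add: has_bochner_integral_iff unit.prob_space[simplified])
  then have *: "has_bochner_integral unit_lborel
      (\<lambda>s. ln K + (ln (norm (1 - p * cis (2 * pi * (s + \<sigma>)))) + ln (norm (1 - q * cis (2 * pi * (s + \<sigma>))))))
      (ln K + (0 + 0))"
    using pq by (intro has_bochner_integral_add has_bochner_integral_ln_norm_one_minus)
  have "AE s in unit_lborel.
      ln K + (ln (norm (1 - p * cis (2 * pi * (s + \<sigma>)))) + ln (norm (1 - q * cis (2 * pi * (s + \<sigma>)))))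
      = ln \<bar>2 * A * cos (2 * pi * (s + \<sigma>)) + B\<bar>"
    using AE_one_minus_cis_nonzero[of p \<sigma>] AE_one_minus_cis_nonzero[of q \<sigma>]
  proof eventually_elim
    case (elim s)
    with K fac[of "cis (2 * pi * (s + \<sigma>))"] show ?case by (simp add: ln_mult)
  qed
  from has_bochner_integral_cong_AE[OF _ _ this] * show ?thesis
    by (simp add: jensen_def K_def)
next
  case False
  \<comment> \<open>With \<open>A = B = 0\<close> both sides are 0 through
    \<open>ln 0 = 0\<close>.\<close>
  then show ?thesis
    by (simp add: jensen_def has_bochner_integral_zero)
qed

text \<open>Used twice: with \<open>c = |A|\<close> for integrability in \<open>t\<close>, and with
  \<open>c\<close> linear in the parameter for the domination as the parameter grows.\<close>

lemma jensen_lower: "A \<noteq> 0 \<or> B \<noteq> 0 \<Longrightarrow> 0 < c \<Longrightarrow> c \<le> max \<bar>A\<bar> (\<bar>B\<bar> / 2) \<Longrightarrow> ln c \<le> jensen A B"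
proof -
  assume *: "A \<noteq> 0 \<or> B \<noteq> 0" "0 < c" "c \<le> max \<bar>A\<bar> (\<bar>B\<bar> / 2)"
  have "c \<le> max \<bar>A\<bar> ((\<bar>B\<bar> + sqrt (B\<^sup>2 - 4 * A\<^sup>2)) / 2)"
  proof (cases "\<bar>B\<bar> \<le> 2 * \<bar>A\<bar>")
    case False
    then have "4 * A\<^sup>2 \<le> B\<^sup>2"
      using power_mono[of "2 * \<bar>A\<bar>" "\<bar>B\<bar>" 2] by (simp add: power_mult_distrib)
    then have "0 \<le> sqrt (B\<^sup>2 - 4 * A\<^sup>2)" by simp
    then have "max \<bar>A\<bar> (\<bar>B\<bar> / 2) \<le> max \<bar>A\<bar> ((\<bar>B\<bar> + sqrt (B\<^sup>2 - 4 * A\<^sup>2)) / 2)"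
      by (intro max.mono) auto
    with *(3) show ?thesis by (rule order_trans)
  qed (use * in auto)
  with * show ?thesis by (simp add: jensen_def)
qed

lemma jensen_upper:
  assumes "A \<noteq> 0 \<or> B \<noteq> 0" "\<bar>A\<bar> \<le> c" "\<bar>B\<bar> \<le> c"
  shows "jensen A B \<le> ln c"
proof -
  have "sqrt (B\<^sup>2 - 4 * A\<^sup>2) \<le> sqrt (B\<^sup>2)" by (intro real_sqrt_le_mono) simp
  then have "max \<bar>A\<bar> ((\<bar>B\<bar> + sqrt (B\<^sup>2 - 4 * A\<^sup>2)) / 2) \<le> c"
    using assms by auto
  with jensen_argument_pos[OF assms(1)] show ?thesis
    by (auto simp: jensen_def intro!: ln_mono)
qed

lemma borel_measurable_jensen [measurable (raw)]:
  assumes [measurable]: "f \<in> borel_measurable M" "g \<in> borel_measurable M"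
  shows "(\<lambda>x. jensen (f x) (g x)) \<in> borel_measurable M"
  unfolding jensen_def by measurable

section \<open>Reduction of the Mahler measure to a single integral\<close>

definition vec2 :: "real \<times> real \<Rightarrow> real ^ 2" where
  "vec2 p = (\<chi> i. if i = 1 then fst p else snd p)"

lemma vec2_nth [simp]: "vec2 p $ 1 = fst p" "vec2 p $ 2 = snd p"
  by (simp_all add: vec2_def)

lemma continuous_vec2: "continuous_on S vec2"
  unfolding vec2_def
proof (rule continuous_on_vec_lambda)
  fix i :: 2
  show "continuous_on S (\<lambda>p. if i = 1 then fst p else snd p)"
    by (cases "i = 1") (auto intro: continuous_intros)
qed

lemma borel_measurable_vec2 [measurable]: "vec2 \<in> borel_measurable borel"
  by (rule borel_measurable_continuous_onI[OF continuous_vec2])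

lemma borel_measurable_vec2_pair [measurable]: "vec2 \<in> borel_measurable (lborel \<Otimes>\<^sub>M lborel)"
  by (simp add: lborel_prod)

text \<open>Lebesgue measure is determined by its values on boxes. This carries the integral over
  \<open>real ^ 2\<close> to a product measure, where Fubini's theorem applies.\<close>

lemma lborel_eq_distr_vec2: "lborel = distr (lborel :: (real \<times> real) measure) borel vec2"
proof (rule lborel_eqI)
  fix l u :: "real ^ 2"
  assume le: "\<And>b. b \<in> Basis \<Longrightarrow> l \<bullet> b \<le> u \<bullet> b"
  then have le': "l $ i \<le> u $ i" for i
    using le[of "axis i 1"] by (simp add: inner_axis)
  have "vec2 -` box l u = {l $ 1<..<u $ 1} \<times> {l $ 2<..<u $ 2}"
    by (auto simp: mem_box_cart forall_2)
  then have "emeasure (distr lborel borel vec2) (box l u) =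
      emeasure (lborel \<Otimes>\<^sub>M lborel) ({l $ 1<..<u $ 1} \<times> {l $ 2<..<u $ 2})"
    by (subst emeasure_distr) (simp_all add: lborel_prod)
  also have "\<dots> = ennreal ((u - l) $ 1) * ennreal ((u - l) $ 2)"
    using le' by (subst lborel.emeasure_pair_measure_Times) simp_all
  also have "\<dots> = ennreal (\<Prod>i\<in>UNIV. (u - l) $ i)"
    using le' by (simp add: UNIV_2 ennreal_mult)
  also have "(\<Prod>i\<in>UNIV. (u - l) $ i) = (\<Prod>b\<in>Basis. (u - l) \<bullet> b)"
    by (rule prod.reindex_bij_betw[of "\<lambda>i. axis i 1" UNIV Basis "\<lambda>b. (u - l) \<bullet> b",
          simplified inner_axis inner_real_def mult_1_right])
       (auto simp: bij_betw_def inj_on_def axis_eq_axis Basis_vec_def)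
  finally show "emeasure (distr lborel borel vec2) (box l u) = (\<Prod>b\<in>Basis. (u - l) \<bullet> b)" .
qed simp

lemma integral_cbox_vec2:
  fixes f :: "real ^ 2 \<Rightarrow> real"
  assumes [measurable]: "f \<in> borel_measurable borel"
  shows "(LINT t : cbox 0 1 | lborel. f t) =
    (\<integral>p. indicator {0..1} (fst p) * (indicator {0..1} (snd p) * f (vec2 p)) \<partial>(lborel \<Otimes>\<^sub>M lborel))"
proof -
  have [measurable]: "cbox 0 1 \<in> sets (borel :: (real ^ 2) measure)" by simp
  have "(LINT t : cbox 0 1 | lborel. f t) =
      (\<integral>p. indicator (cbox 0 1) (vec2 p) *\<^sub>R f (vec2 p) \<partial>lborel)"
    unfolding set_lebesgue_integral_def by (subst lborel_eq_distr_vec2, subst integral_distr) simp_all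
  also have "(\<lambda>p. indicator (cbox 0 1) (vec2 p) *\<^sub>R f (vec2 p)) =
      (\<lambda>p. indicator {0..1} (fst p) * (indicator {0..1} (snd p) * f (vec2 p)))"
    by (auto simp: fun_eq_iff mem_box_cart forall_2 split: split_indicator)
  finally show ?thesis by (simp add: lborel_prod)
qed

lemma integrable_unit_lborel_iff:
  fixes f :: "real \<Rightarrow> real"
  shows "integrable unit_lborel f \<longleftrightarrow> integrable lborel (\<lambda>t. indicator {0..1} t * f t)"
  by (subst integrable_restrict_space) (simp_all add: set_integrable_def)

text \<open>The value is squeezed between \<open>ln |A t|\<close> and \<open>ln c\<close>, so only
  the zeros of \<open>A\<close> can be harmful.\<close>

lemma integrable_jensen:
  assumes [measurable]: "A \<in> borel_measurable borel" "B \<in> borel_measurable borel"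
    and bound: "\<And>t. t \<in> {0..1} \<Longrightarrow> \<bar>A t\<bar> \<le> c \<and> \<bar>B t\<bar> \<le> c"
    and lnA: "integrable unit_lborel (\<lambda>t. ln \<bar>A t\<bar>)"
    and A0: "AE t in unit_lborel. A t \<noteq> 0"
  shows "integrable unit_lborel (\<lambda>t. jensen (A t) (B t))"
proof (rule Bochner_Integration.integrable_bound)
  show "integrable unit_lborel (\<lambda>t. \<bar>ln \<bar>A t\<bar>\<bar> + \<bar>ln c\<bar>)"
    using lnA by (intro Bochner_Integration.integrable_add integrable_abs) simp_all
  show "AE t in unit_lborel. norm (jensen (A t) (B t)) \<le> norm (\<bar>ln \<bar>A t\<bar>\<bar> + \<bar>ln c\<bar>)"
    using A0 AE_space
  proof eventually_elim
    case (elim t)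
    then have t: "t \<in> {0..1}" by (simp add: space_restrict_space)
    have "ln \<bar>A t\<bar> \<le> jensen (A t) (B t)"
      using elim by (intro jensen_lower) auto
    moreover have "jensen (A t) (B t) \<le> ln c"
      using elim bound[OF t] by (intro jensen_upper) auto
    ultimately show ?case by auto
  qed
qed simp

text \<open>Fubini's theorem requires absolute integrability. The logarithm \<open>f\<close> is
  bounded above by \<open>ln d \<ge> 0\<close>, so \<open>|f| \<le> 2 * ln d - f\<close>; Jensen's
  formula integrates the right side in \<open>s\<close>, and the result is at most
  \<open>2 * ln d - ln |A t|\<close>.\<close>

lemma mahler_measure_eq_integral_jensen:
  fixes P :: "complex \<Rightarrow> complex \<Rightarrow> complex"
  assumes cont: "continuous_on UNIV (\<lambda>z :: complex ^ 2. P (z $ 1) (z $ 2))"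
    and fac: "\<And>t s. norm (P (cis (2 * pi * t)) (cis (2 * pi * s))) = \<bar>2 * A t * cos (2 * pi * (s + \<sigma> t)) + B t\<bar>"
    and AB [measurable]: "A \<in> borel_measurable borel" "B \<in> borel_measurable borel"
    and bound: "\<And>t. t \<in> {0..1} \<Longrightarrow> \<bar>A t\<bar> \<le> c \<and> \<bar>B t\<bar> \<le> c"
    and lnA: "integrable unit_lborel (\<lambda>t. ln \<bar>A t\<bar>)"
    and A0: "AE t in unit_lborel. A t \<noteq> 0"
  shows "mahler_measure (\<lambda>z :: complex ^ 2. P (z $ 1) (z $ 2)) =
    of_real (\<integral>t. jensen (A t) (B t) \<partial>unit_lborel)"
proof -
  define F where "F v = ln (norm (P (torus_point v $ 1) (torus_point v $ 2)))" for v :: "real ^ 2"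
  have "continuous_on UNIV (torus_point :: real ^ 2 \<Rightarrow> complex ^ 2)"
    unfolding torus_point_def by (intro continuous_on_vec_lambda continuous_intros)
  from continuous_on_compose2[OF cont this]
  have "continuous_on UNIV (\<lambda>v :: real ^ 2. norm (P (torus_point v $ 1) (torus_point v $ 2)))"
    by (intro continuous_on_norm) simp
  then have [measurable]: "F \<in> borel_measurable borel"
    unfolding F_def by (intro borel_measurable_ln borel_measurable_continuous_onI)
  define f where "f t s = F (vec2 (t, s))" for t s
  have f: "f t s = ln \<bar>2 * A t * cos (2 * pi * (s + \<sigma> t)) + B t\<bar>" for t s
    by (simp add: f_def F_def torus_point_def flip: fac)
       (simp add: cis_conv_exp mult_ac)
  \<comment> \<open>Joint measurability comes from the continuity of \<open>P\<close>; the rotation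
    \<open>\<sigma>\<close> in \<open>fac\<close> is an arbitrary function.\<close>
  have [measurable]: "(\<lambda>p. f (fst p) (snd p)) \<in> borel_measurable (lborel \<Otimes>\<^sub>M lborel)"
    unfolding f_def by simp
  have [measurable]: "f t \<in> borel_measurable borel" for t
    unfolding f_def by simp
  define g where "g p = indicator {0..1} (fst p) * (indicator {0..1} (snd p) * f (fst p) (snd p))" for p :: "real \<times> real"
  have [measurable]: "g \<in> borel_measurable (lborel \<Otimes>\<^sub>M lborel)"
    unfolding g_def by measurable
  have J: "has_bochner_integral unit_lborel (f t) (jensen (A t) (B t))" for t
    using has_bochner_integral_jensen[of "A t" "\<sigma> t" "B t"] by (simp add: f[abs_def])
  \<comment> \<open>\<open>3 * c\<close> bounds \<open>2 |A| + |B|\<close>. The maximum with 1 makes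
    \<open>ln d\<close> nonnegative, which also covers the points where \<open>f\<close> is
    \<open>ln 0 = 0\<close>.\<close>
  define d where "d = max 1 (3 * c)"
  have f_le: "f t s \<le> ln d" if "t \<in> {0..1}" for t s
  proof -
    have c: "\<bar>A t\<bar> \<le> c" "\<bar>B t\<bar> \<le> c" using bound[OF that] by auto
    have "\<bar>2 * A t * cos (2 * pi * (s + \<sigma> t))\<bar> \<le> 2 * \<bar>A t\<bar> * 1"
      unfolding abs_mult by (intro mult_mono) auto
    then have "\<bar>2 * A t * cos (2 * pi * (s + \<sigma> t)) + B t\<bar> \<le> d"
      using c unfolding d_def by linarith
    then show ?thesis
      unfolding f by (cases "2 * A t * cos (2 * pi * (s + \<sigma> t)) + B t = 0") (auto simp: d_def)
  qed
  have intg: "integrable (lborel \<Otimes>\<^sub>M lborel) g"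
  proof (rule lborel_pair.Fubini_integrable)
    have eq: "(\<integral>s. norm (g (t, s)) \<partial>lborel) = indicator {0..1} t * (\<integral>s. \<bar>f t s\<bar> \<partial>unit_lborel)" for t
      by (simp add: g_def integral_unit_lborel abs_mult)
    have "integrable unit_lborel (\<lambda>t. \<integral>s. \<bar>f t s\<bar> \<partial>unit_lborel)"
    proof (rule Bochner_Integration.integrable_bound)
      show "integrable unit_lborel (\<lambda>t. 2 * ln d - ln \<bar>A t\<bar>)"
        using lnA by (intro Bochner_Integration.integrable_diff) simp_all
      have "(\<lambda>t. \<integral>s. indicator {0..1} s * \<bar>f t s\<bar> \<partial>lborel) \<in> borel_measurable lborel"
        by (rule lborel.borel_measurable_lebesgue_integral) (simp add: case_prod_beta)
      then show "(\<lambda>t. \<integral>s. \<bar>f t s\<bar> \<partial>unit_lborel) \<in> borel_measurable unit_lborel"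
        by (simp add: integral_unit_lborel)
      show "AE t in unit_lborel. norm (\<integral>s. \<bar>f t s\<bar> \<partial>unit_lborel) \<le> norm (2 * ln d - ln \<bar>A t\<bar>)"
        using A0 AE_space
      proof eventually_elim
        case (elim t)
        then have t: "t \<in> {0..1}" by (simp add: space_restrict_space)
        have i: "integrable unit_lborel (f t)" using J by (simp add: has_bochner_integral_iff)
        have "0 \<le> (\<integral>s. \<bar>f t s\<bar> \<partial>unit_lborel)" by simp
        have "(\<integral>s. \<bar>f t s\<bar> \<partial>unit_lborel) \<le> (\<integral>s. 2 * ln d - f t s \<partial>unit_lborel)"
        proof (rule integral_mono)
          fix s
          have "0 \<le> ln d" by (simp add: d_def)
          with f_le[OF t, of s] show "\<bar>f t s\<bar> \<le> 2 * ln d - f t s" by linarith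
        qed (use i in simp_all)
        also have "\<dots> = 2 * ln d - jensen (A t) (B t)"
          using i has_bochner_integral_integral_eq[OF J] by (simp add: unit.prob_space[simplified])
        also have "\<dots> \<le> 2 * ln d - ln \<bar>A t\<bar>"
          using elim by (simp, intro jensen_lower) auto
        finally show ?case by simp
      qed
    qed
    then show "integrable lborel (\<lambda>t. \<integral>s. norm (g (t, s)) \<partial>lborel)"
      unfolding eq integrable_unit_lborel_iff .
    have "integrable lborel (\<lambda>s. g (t, s))" for t
      using J[of t] by (simp add: g_def integrable_unit_lborel_iff has_bochner_integral_iff)
    then show "AE t in lborel. integrable lborel (\<lambda>s. g (t, s))" by simp
  qed simp
  have "(LINT v : cbox 0 1 | lborel. F v) = (\<integral>p. g p \<partial>(lborel \<Otimes>\<^sub>M lborel))"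
    by (simp add: integral_cbox_vec2 g_def f_def)
  also have "\<dots> = (\<integral>t. \<integral>s. g (t, s) \<partial>lborel \<partial>lborel)"
    using lborel_pair.integral_fst'[OF intg] by simp
  also have "\<dots> = (\<integral>t. indicator {0..1} t * jensen (A t) (B t) \<partial>lborel)"
    using has_bochner_integral_integral_eq[OF J] by (simp add: g_def flip: integral_unit_lborel)
  also have "\<dots> = (\<integral>t. jensen (A t) (B t) \<partial>unit_lborel)"
    by (simp add: integral_unit_lborel)
  finally show ?thesis
    unfolding mahler_measure_eq_real F_def by simp
qed

section \<open>Differentiation with respect to the parameter\<close>

text \<open>Meant for \<open>B > - 2 * |A|\<close> only. Since \<open>jensen\<close> is even in
  \<open>B\<close>, its true derivative is negative below that range, and nonnegativity is what
  Tonelli's theorem asks for.\<close>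

definition jensen_deriv :: "real \<Rightarrow> real \<Rightarrow> real" where
  "jensen_deriv A B = (if 2 * \<bar>A\<bar> < B then 1 / sqrt (B\<^sup>2 - 4 * A\<^sup>2) else 0)"

lemma four_square_le_iff: "4 * A\<^sup>2 \<le> B\<^sup>2 \<longleftrightarrow> 2 * \<bar>A\<bar> \<le> \<bar>B :: real\<bar>"
  using abs_le_square_iff[of "2 * A" B] by (simp add: abs_mult power_mult_distrib)

lemma four_square_less_iff: "4 * A\<^sup>2 < B\<^sup>2 \<longleftrightarrow> 2 * \<bar>A\<bar> < \<bar>B :: real\<bar>"
  using four_square_le_iff[of B A] abs_le_square_iff[of B "2 * A"]
  by (simp add: abs_mult power_mult_distrib flip: not_le)

lemma jensen_deriv_nonneg: "0 \<le> jensen_deriv A B"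
  by (auto simp: jensen_deriv_def four_square_le_iff)

lemma borel_measurable_jensen_deriv [measurable (raw)]:
  assumes [measurable]: "f \<in> borel_measurable M" "g \<in> borel_measurable M"
  shows "(\<lambda>x. jensen_deriv (f x) (g x)) \<in> borel_measurable M"
  unfolding jensen_deriv_def by measurable

lemma jensen_eq_elliptic: "\<bar>B\<bar> \<le> 2 * \<bar>A\<bar> \<Longrightarrow> jensen A B = ln \<bar>A\<bar>"
proof -
  assume B: "\<bar>B\<bar> \<le> 2 * \<bar>A\<bar>"
  then have "B\<^sup>2 \<le> 4 * A\<^sup>2"
    using abs_le_square_iff[of B "2 * A"] by (simp add: abs_mult power_mult_distrib)
  then have "sqrt (B\<^sup>2 - 4 * A\<^sup>2) \<le> 0" by simp
  from add_mono[OF B this] show ?thesis by (simp add: jensen_def max_absorb1)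
qed

lemma jensen_eq_hyperbolic:
  assumes "2 * \<bar>A\<bar> \<le> B"
  shows "jensen A B = ln ((B + sqrt (B\<^sup>2 - 4 * A\<^sup>2)) / 2)"
proof -
  have "0 \<le> sqrt (B\<^sup>2 - 4 * A\<^sup>2)" using assms by (simp add: four_square_le_iff)
  from add_mono[OF assms this] assms show ?thesis by (simp add: jensen_def max_absorb2)
qed

text \<open>For nonzero \<open>A\<close> the function is constant while \<open>|B| < 2 * |A|\<close>
  and equals \<open>ln |A| + arcosh (B / (2 * |A|))\<close> beyond.\<close>

lemma has_real_derivative_jensen:
  assumes "- 2 * \<bar>A\<bar> < B" "B \<noteq> 2 * \<bar>A\<bar>"
  shows "(jensen A has_real_derivative jensen_deriv A B) (at B)"
proof (cases "B < 2 * \<bar>A\<bar>")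
  case True
  have "((\<lambda>B. ln \<bar>A\<bar>) has_real_derivative 0) (at B)" by simp
  then have "(jensen A has_real_derivative 0) (at B)"
    by (rule has_field_derivative_transform_within_open[where S = "{- 2 * \<bar>A\<bar> <..< 2 * \<bar>A\<bar>}"])
      (use True assms in \<open>auto intro!: jensen_eq_elliptic[symmetric]\<close>)
  with True show ?thesis by (simp add: jensen_deriv_def)
next
  case False
  with assms have B: "2 * \<bar>A\<bar> < B" by simp
  then have pos: "0 < B\<^sup>2 - 4 * A\<^sup>2" by (simp add: four_square_less_iff)
  define r where "r = sqrt (B\<^sup>2 - 4 * A\<^sup>2)"
  have r: "0 < r" using pos by (simp add: r_def)
  have B0: "0 < B" using B by auto
  have "((\<lambda>B. ln ((B + sqrt (B\<^sup>2 - 4 * A\<^sup>2)) / 2)) has_real_derivative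
      (1 + inverse r / 2 * (2 * B)) / 2 * inverse ((B + r) / 2)) (at B)"
  proof (rule DERIV_chain2[OF DERIV_ln, THEN DERIV_cong])
    have "((\<lambda>B. B\<^sup>2 - 4 * A\<^sup>2) has_real_derivative 2 * B) (at B)"
      by (auto intro!: derivative_eq_intros)
    with pos have "((\<lambda>B. sqrt (B\<^sup>2 - 4 * A\<^sup>2)) has_real_derivative inverse r / 2 * (2 * B)) (at B)"
      unfolding r_def by (intro DERIV_chain2[OF DERIV_real_sqrt])
    then show "((\<lambda>B. (B + sqrt (B\<^sup>2 - 4 * A\<^sup>2)) / 2) has_real_derivative
        (1 + inverse r / 2 * (2 * B)) / 2) (at B)"
      by (intro DERIV_cdivide DERIV_add DERIV_ident)
  qed (use r B0 in \<open>simp_all add: r_def[symmetric] mult.commute\<close>)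
  also have "1 + inverse r / 2 * (2 * B) = (B + r) / r"
    using r by (simp add: field_simps)
  also have "(B + r) / r / 2 * inverse ((B + r) / 2) = 1 / r"
    using r B0 add_pos_pos[OF B0 r] by (simp add: divide_simps)
  finally have "(jensen A has_real_derivative 1 / r) (at B)"
    by (rule has_field_derivative_transform_within_open[where S = "{2 * \<bar>A\<bar> <..}"])
      (use B in \<open>auto intro!: jensen_eq_hyperbolic[symmetric]\<close>)
  with B show ?thesis by (simp add: jensen_deriv_def r_def)
qed

lemma continuous_on_jensen: "A \<noteq> 0 \<Longrightarrow> continuous_on S (jensen A)"
  unfolding jensen_def[abs_def]
  by (intro continuous_on_ln continuous_on_max continuous_intros) (use jensen_argument_pos[of A] in force)+

text \<open>The derivative is infinite where \<open>p + q * x = 2 * |A|\<close>, but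
  \<open>jensen A\<close> is continuous there. The fundamental theorem with this one exceptional
  point therefore applies, and it is enough to have derivatives in the open interval, so equality is
  allowed in \<open>lo\<close>.\<close>

lemma nn_integral_jensen_deriv:
  assumes A: "A \<noteq> 0" and q: "0 < q" and lo: "- 2 * \<bar>A\<bar> \<le> p + q * a" and ab: "a \<le> b"
  shows "(\<integral>\<^sup>+x. ennreal (q * jensen_deriv A (p + q * x)) * indicator {a..b} x \<partial>lborel) =
    ennreal (jensen A (p + q * b) - jensen A (p + q * a))"
    and jensen_mono: "jensen A (p + q * a) \<le> jensen A (p + q * b)"
proof -
  have I: "((\<lambda>x. q * jensen_deriv A (p + q * x)) has_integral jensen A (p + q * b) - jensen A (p + q * a)) {a..b}"
  proof (rule fundamental_theorem_of_calculus_interior_strong[where S = "{(2 * \<bar>A\<bar> - p) / q}"])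
    fix x assume x: "x \<in> {a<..<b} - {(2 * \<bar>A\<bar> - p) / q}"
    have "q * a < q * x" using x q by simp
    with lo have "- 2 * \<bar>A\<bar> < p + q * x" by linarith
    moreover have "p + q * x \<noteq> 2 * \<bar>A\<bar>" using x q by (auto simp: field_simps)
    ultimately have "(jensen A has_real_derivative jensen_deriv A (p + q * x)) (at (p + q * x))"
      by (rule has_real_derivative_jensen)
    moreover have "((\<lambda>x. p + q * x) has_real_derivative q) (at x)"
      by (auto intro!: derivative_eq_intros)
    ultimately have "((\<lambda>x. jensen A (p + q * x)) has_real_derivative jensen_deriv A (p + q * x) * q) (at x)"
      by (rule DERIV_chain2)
    then show "((\<lambda>x. jensen A (p + q * x)) has_vector_derivative q * jensen_deriv A (p + q * x)) (at x)"
      by (simp add: has_real_derivative_iff_has_vector_derivative mult.commute)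
  next
    show "continuous_on {a..b} (\<lambda>x. jensen A (p + q * x))"
      by (rule continuous_on_compose2[OF continuous_on_jensen[OF A, of UNIV]])
        (auto intro!: continuous_intros)
  qed (use ab in auto)
  have "0 \<le> jensen A (p + q * b) - jensen A (p + q * a)"
    by (rule has_integral_nonneg[OF I]) (use q jensen_deriv_nonneg in auto)
  then show "jensen A (p + q * a) \<le> jensen A (p + q * b)" by simp
  from I have "((\<lambda>x. if x \<in> {a..b} then q * jensen_deriv A (p + q * x) else 0) has_integral
      jensen A (p + q * b) - jensen A (p + q * a)) UNIV"
    by (simp only: has_integral_restrict_UNIV)
  then have "(\<integral>\<^sup>+x. ennreal (if x \<in> {a..b} then q * jensen_deriv A (p + q * x) else 0) \<partial>lborel) =
      ennreal (jensen A (p + q * b) - jensen A (p + q * a))"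
    by (intro nn_integral_has_integral_lborel) (use q jensen_deriv_nonneg in auto)
  also have "(\<lambda>x. ennreal (if x \<in> {a..b} then q * jensen_deriv A (p + q * x) else 0)) =
      (\<lambda>x. ennreal (q * jensen_deriv A (p + q * x)) * indicator {a..b} x)"
    by (auto split: split_indicator)
  finally show "(\<integral>\<^sup>+x. ennreal (q * jensen_deriv A (p + q * x)) * indicator {a..b} x \<partial>lborel) =
    ennreal (jensen A (p + q * b) - jensen A (p + q * a))" .
qed

section \<open>Change of variables to the squared chord length\<close>

lemma nn_integral_substitution_ennreal:
  fixes f g g' :: "real \<Rightarrow> real"
  assumes "set_borel_measurable borel {g a..g b} f"
    and "\<And>x. x \<in> {a..b} \<Longrightarrow> (g has_real_derivative g' x) (at x)"
    and "continuous_on {a..b} g'" "\<And>x. x \<in> {a..b} \<Longrightarrow> g' x \<ge> 0" "a \<le> b"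
  shows "(\<integral>\<^sup>+x. ennreal (f x) * indicator {g a..g b} x \<partial>lborel) =
    (\<integral>\<^sup>+x. ennreal (f (g x) * g' x) * indicator {a..b} x \<partial>lborel)"
proof -
  have "ennreal r * indicator S x = ennreal (r * indicator S x)" for r x :: real and S
    by (simp split: split_indicator)
  then show ?thesis using nn_integral_substitution[OF assms] by simp
qed

text \<open>\<open>2 + 2 * cos (2 * pi * t)\<close> has the arcsine law on \<open>{0..4}\<close>.
  The graph is symmetric about \<open>t = 1/2\<close>; the half \<open>{1/2..1}\<close> is kept
  because the cosine increases there, as the substitution rule demands.\<close>

lemma nn_integral_unit_lborel_cos:
  fixes F :: "real \<Rightarrow> real"
  assumes [measurable]: "F \<in> borel_measurable borel"
  shows "(\<integral>\<^sup>+t. F (2 + 2 * cos (2 * pi * t)) \<partial>unit_lborel) =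
    (\<integral>\<^sup>+v. ennreal (F v / (pi * sqrt (v * (4 - v)))) * indicator {0..4} v \<partial>lborel)"
proof -
  define h where "h t = ennreal (F (2 + 2 * cos (2 * pi * t)))" for t
  have [measurable]: "h \<in> borel_measurable borel" unfolding h_def by measurable
  have sym: "h (1 - t) = h t" for t
    by (simp add: h_def right_diff_distrib cos_diff)
  let ?H = "\<integral>\<^sup>+t. h t * indicator {1/2..1} t \<partial>lborel"
  have "(\<integral>\<^sup>+t. h t \<partial>unit_lborel) =
      (\<integral>\<^sup>+t. h t * indicator {0..1/2} t + h t * indicator {1/2..1} t \<partial>lborel)"
    unfolding nn_integral_unit_lborel[OF \<open>h \<in> borel_measurable borel\<close>]
    by (rule nn_integral_cong_AE)
      (use AE_lborel_singleton[of "1/2::real"] in \<open>eventually_elim, auto split: split_indicator\<close>)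
  also have "\<dots> = (\<integral>\<^sup>+t. h t * indicator {0..1/2} t \<partial>lborel) + ?H"
    by (rule nn_integral_add) simp_all
  also have "(\<integral>\<^sup>+t. h t * indicator {0..1/2} t \<partial>lborel) = ?H"
    by (subst nn_integral_real_affine[of _ "-1" 1])
      (auto intro!: nn_integral_cong simp: sym split: split_indicator)
  also have "?H + ?H = (\<integral>\<^sup>+t. 2 * (h t * indicator {1/2..1} t) \<partial>lborel)"
    by (subst nn_integral_cmult) (simp_all add: mult_2)
  also have "\<dots> = (\<integral>\<^sup>+t. ennreal (F (2 + 2 * cos (2 * pi * t)) /
      (pi * sqrt ((2 + 2 * cos (2 * pi * t)) * (4 - (2 + 2 * cos (2 * pi * t))))) *
      (- 4 * pi * sin (2 * pi * t))) * indicator {1/2..1} t \<partial>lborel)"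
  proof (rule nn_integral_cong_AE)
    show "AE t in lborel. 2 * (h t * indicator {1/2..1} t) =
      ennreal (F (2 + 2 * cos (2 * pi * t)) /
      (pi * sqrt ((2 + 2 * cos (2 * pi * t)) * (4 - (2 + 2 * cos (2 * pi * t))))) *
      (- 4 * pi * sin (2 * pi * t))) * indicator {1/2..1} t"
      using AE_lborel_singleton[of "1/2::real"] AE_lborel_singleton[of "1::real"]
    proof eventually_elim
      case (elim t)
      show ?case
      proof (cases "t \<in> {1/2..1}")
        case True
        with elim have t: "1/2 < t" "t < 1" by auto
        have "0 < sin (2 * pi * t - pi)"
          using t by (intro sin_gt_zero) (auto simp: field_simps)
        then have s: "sin (2 * pi * t) < 0" by (simp add: sin_diff)
        have "(2 + 2 * cos (2 * pi * t)) * (4 - (2 + 2 * cos (2 * pi * t))) = (2 * sin (2 * pi * t))\<^sup>2"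
          unfolding power_mult_distrib sin_squared_eq by (simp add: algebra_simps power2_eq_square)
        then have "sqrt ((2 + 2 * cos (2 * pi * t)) * (4 - (2 + 2 * cos (2 * pi * t)))) = - 2 * sin (2 * pi * t)"
          using s by (simp only: real_sqrt_abs)
        then have "F (2 + 2 * cos (2 * pi * t)) /
            (pi * sqrt ((2 + 2 * cos (2 * pi * t)) * (4 - (2 + 2 * cos (2 * pi * t))))) *
            (- 4 * pi * sin (2 * pi * t)) = 2 * F (2 + 2 * cos (2 * pi * t))"
          using s by (simp only:) (simp add: field_simps)
        with True show ?thesis by (simp add: h_def ennreal_mult')
      qed simp
    qed
  qed
  also have "\<dots> = (\<integral>\<^sup>+v. ennreal (F v / (pi * sqrt (v * (4 - v)))) *
      indicator {2 + 2 * cos (2 * pi * (1/2)) .. 2 + 2 * cos (2 * pi * 1)} v \<partial>lborel)"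
  proof -
    have 1: "set_borel_measurable borel {2 + 2 * cos (2 * pi * (1/2)) .. 2 + 2 * cos (2 * pi * 1)}
        (\<lambda>v. F v / (pi * sqrt (v * (4 - v))))"
      unfolding set_borel_measurable_def by measurable
    have 2: "((\<lambda>t. 2 + 2 * cos (2 * pi * t)) has_real_derivative - 4 * pi * sin (2 * pi * t)) (at t)" for t
      by (auto intro!: derivative_eq_intros)
    have 3: "- 4 * pi * sin (2 * pi * t) \<ge> 0" if t: "t \<in> {1/2..1}" for t
    proof -
      have "0 \<le> sin (2 * pi * t - pi)"
        using t by (intro sin_ge_zero) (auto simp: field_simps)
      then show ?thesis by (simp add: sin_diff mult_nonneg_nonpos)
    qed
    show ?thesis
      by (rule nn_integral_substitution_ennreal[symmetric, OF 1 2 _ 3]) (auto intro!: continuous_intros)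
  qed
  finally show ?thesis by (simp add: h_def)
qed

section \<open>Equality of the elliptic integrals\<close>

text \<open>Parameter derivatives of the inner means as functions of \<open>v = |1 + x|^2\<close>;
  the leading factors \<open>sqrt v\<close> and \<open>v\<close> below come from the chain
  rule.\<close>

definition Q_deriv :: "real \<Rightarrow> real \<Rightarrow> real" where
  "Q_deriv a v = sqrt v * jensen_deriv (v - 1) (a * sqrt v)"

definition R_deriv :: "real \<Rightarrow> real \<Rightarrow> real" where
  "R_deriv a v = v * jensen_deriv (v - 1) (v\<^sup>2 - 2 * v - 2 + v * a)"

text \<open>The chain rule factor \<open>sqrt v\<close> cancels against the arcsine density, and a
  cubic in \<open>v\<close> remains under the root.\<close>

lemma Q_deriv_period:
  assumes a: "4 \<le> a" and v: "0 < v" "v < 4"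
  defines "M \<equiv> a\<^sup>2 * v - 4 * (v - 1)\<^sup>2"
  shows "Q_deriv a v / (pi * sqrt (v * (4 - v))) = (if 0 < M then 1 / (pi * sqrt (M * (4 - v))) else 0)"
proof -
  have sq: "(a * sqrt v)\<^sup>2 - 4 * (v - 1)\<^sup>2 = M"
    using v by (simp add: M_def power_mult_distrib)
  have "2 * \<bar>v - 1\<bar> < a * sqrt v \<longleftrightarrow> 2 * \<bar>v - 1\<bar> < \<bar>a * sqrt v\<bar>"
    using a v by (simp add: abs_mult)
  also have "\<dots> \<longleftrightarrow> 0 < M"
    unfolding sq[symmetric] by (simp add: four_square_less_iff)
  finally have iff: "2 * \<bar>v - 1\<bar> < a * sqrt v \<longleftrightarrow> 0 < M" .
  show ?thesis
    unfolding Q_deriv_def jensen_deriv_def iff sq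
    using v by (simp add: real_sqrt_mult)
qed

text \<open>With \<open>A = x - 1\<close>, the difference of squares splits as
  \<open>B - 2 A = x * (x + a - 4)\<close> times \<open>B + 2 A = N\<close>. The first factor is
  positive for \<open>a \<ge> 4\<close>, so the sign of \<open>N\<close> decides; the chain rule
  factor \<open>x\<close> cancels and a quartic remains.\<close>

lemma R_deriv_period:
  assumes a: "4 \<le> a" and x: "0 < x" "x < 4"
  defines "N \<equiv> x\<^sup>2 + a * x - 4"
  shows "R_deriv a x / (pi * sqrt (x * (4 - x))) =
    (if 0 < N then 1 / (pi * sqrt ((x + a - 4) * N * (4 - x))) else 0)"
proof -
  define B where "B = x\<^sup>2 - 2 * x - 2 + x * a"
  have sq: "B\<^sup>2 - 4 * (x - 1)\<^sup>2 = x * (x + a - 4) * N"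
    by (simp add: B_def N_def power2_eq_square algebra_simps)
  have "0 < x * (x + a - 4)" using a x by simp
  then have "2 * (x - 1) < B" by (simp add: B_def power2_eq_square algebra_simps)
  then have iff: "2 * \<bar>x - 1\<bar> < B \<longleftrightarrow> 0 < N"
    by (auto simp: B_def N_def abs_if algebra_simps)
  have "sqrt (x * (x + a - 4) * N) * sqrt (x * (4 - x)) = sqrt (x\<^sup>2 * ((x + a - 4) * N * (4 - x)))"
    by (simp add: power2_eq_square mult_ac flip: real_sqrt_mult)
  also have "\<dots> = x * sqrt ((x + a - 4) * N * (4 - x))"
    using x by (simp only: real_sqrt_mult) simp
  finally have r: "sqrt (x * (x + a - 4) * N) * sqrt (x * (4 - x)) = x * sqrt ((x + a - 4) * N * (4 - x))" .
  have "R_deriv a x / (pi * sqrt (x * (4 - x))) =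
      (if 0 < N then x / (pi * (sqrt (x * (x + a - 4) * N) * sqrt (x * (4 - x)))) else 0)"
    unfolding R_deriv_def B_def[symmetric] jensen_deriv_def iff sq by simp
  then show ?thesis unfolding r using x by simp
qed

text \<open>
  The Moebius map \<open>v \<mapsto> 4 - a + a (a - 3) / (a + 1 - v)\<close> fixes \<open>4\<close> and carries the branch points
  of the elliptic integral of \<open>Q_deriv\<close> (\<open>4\<close>, \<open>\<infinity>\<close> and the roots of \<open>a\<^sup>2 v - 4 (v - 1)\<^sup>2\<close>) to those of the
  one of \<open>R_deriv\<close> (\<open>4\<close>, \<open>4 - a\<close> and the roots of \<open>x\<^sup>2 + a x - 4\<close>).
\<close>

lemma R_deriv_moebius:
  assumes a: "4 \<le> a" and v: "0 < v" "v < 4"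
  defines "x \<equiv> 4 - a + a * (a - 3) / (a + 1 - v)"
  shows "R_deriv a x / (pi * sqrt (x * (4 - x))) * (a * (a - 3) / (a + 1 - v)\<^sup>2) =
    Q_deriv a v / (pi * sqrt (v * (4 - v)))"
proof -
  define D where "D = a + 1 - v"
  define M where "M = a\<^sup>2 * v - 4 * (v - 1)\<^sup>2"
  define k where "k = a * (a - 3) / D\<^sup>2"
  have D: "0 < D" using a v by (simp add: D_def)
  have k: "0 < k" using a D by (simp add: k_def)
  have x4: "4 - x = a * (4 - v) / D"
    using D by (simp add: x_def D_def field_simps)
  have "0 < a * (4 - v) / D" using a v D by simp
  then have xlt: "x < 4" unfolding x4[symmetric] by simp
  have x: "x = (4 + v * (a - 4)) / D"
    using D by (simp add: x_def D_def field_simps)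
  have "0 < 4 + v * (a - 4)" using a v by (intro add_pos_nonneg) auto
  then have xpos: "0 < x" using D by (simp add: x)
  have xa: "x + a - 4 = a * (a - 3) / D" by (simp add: x_def D_def)
  have N: "x\<^sup>2 + a * x - 4 = (a - 3) * M / D\<^sup>2"
  proof -
    have "x\<^sup>2 + a * x - 4 = ((4 + v * (a - 4))\<^sup>2 + a * (4 + v * (a - 4)) * D - 4 * D\<^sup>2) / D\<^sup>2"
      unfolding x using D by (simp add: field_simps power2_eq_square)
    also have "(4 + v * (a - 4))\<^sup>2 + a * (4 + v * (a - 4)) * D - 4 * D\<^sup>2 = (a - 3) * M"
      unfolding M_def D_def by algebra
    finally show ?thesis .
  qed
  have iff: "0 < x\<^sup>2 + a * x - 4 \<longleftrightarrow> 0 < M"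
    unfolding N using a D by (simp add: zero_less_divide_iff zero_less_mult_iff)
  \<comment> \<open>The three factors together produce the square of the Jacobian \<open>k\<close>,
    so the root cancels the Jacobian exactly.\<close>
  have "(x + a - 4) * (x\<^sup>2 + a * x - 4) * (4 - x) = k\<^sup>2 * (M * (4 - v))"
    unfolding xa N x4 k_def using D by (simp add: field_simps power2_eq_square)
  then have r: "sqrt ((x + a - 4) * (x\<^sup>2 + a * x - 4) * (4 - x)) = k * sqrt (M * (4 - v))"
    using k by (simp add: real_sqrt_mult)
  have "R_deriv a x / (pi * sqrt (x * (4 - x))) * k =
      (if 0 < M then 1 / (pi * (k * sqrt (M * (4 - v)))) else 0) * k"
    unfolding R_deriv_period[OF a xpos xlt] iff r ..
  also have "\<dots> = Q_deriv a v / (pi * sqrt (v * (4 - v)))"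
    unfolding Q_deriv_period[OF a v] M_def[symmetric] using k by simp
  finally show ?thesis by (simp add: k_def D_def)
qed

text \<open>The Moebius map sends \<open>{0..4}\<close> onto \<open>{4 / (a + 1)..4}\<close> only;
  the missed piece contributes nothing. There \<open>x \<le> 1\<close>, hence
  \<open>x^2 + a * x - 4 \<le> (a + 1) * x - 4 \<le> 0\<close>.\<close>

lemma R_deriv_eq_0:
  assumes a: "4 \<le> a" and x: "0 < x" "x \<le> 4 / (a + 1)"
  shows "R_deriv a x / (pi * sqrt (x * (4 - x))) = 0"
proof -
  have "x * (a + 1) \<le> 4" using a x by (simp add: field_simps)
  moreover have "4 / (a + 1) \<le> 1" using a by simp
  with x have "x \<le> 1" by linarith
  then have "x * x \<le> x * 1" using x by (intro mult_left_mono) auto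
  ultimately have "x\<^sup>2 + a * x - 4 \<le> 0" by (simp add: power2_eq_square algebra_simps)
  then show ?thesis using R_deriv_period[OF a x(1)] \<open>x \<le> 1\<close> by simp
qed

lemma nn_integral_Q_deriv_eq_R_deriv:
  assumes a: "4 \<le> a"
  shows "(\<integral>\<^sup>+t. Q_deriv a (2 + 2 * cos (2 * pi * t)) \<partial>unit_lborel) =
    (\<integral>\<^sup>+t. R_deriv a (2 + 2 * cos (2 * pi * t)) \<partial>unit_lborel)"
proof -
  define g where "g v = 4 - a + a * (a - 3) / (a + 1 - v)" for v
  define G where "G x = R_deriv a x / (pi * sqrt (x * (4 - x)))" for x
  have mQ [measurable]: "Q_deriv a \<in> borel_measurable borel"
    unfolding Q_deriv_def[abs_def] by measurable
  have mR [measurable]: "R_deriv a \<in> borel_measurable borel"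
    unfolding R_deriv_def[abs_def] by measurable
  have [measurable]: "G \<in> borel_measurable borel" unfolding G_def by measurable
  have g0: "g 0 = 4 / (a + 1)" using a by (simp add: g_def field_simps)
  have g4: "g 4 = 4" using a by (simp add: g_def field_simps)
  have "(\<integral>\<^sup>+t. Q_deriv a (2 + 2 * cos (2 * pi * t)) \<partial>unit_lborel) =
      (\<integral>\<^sup>+v. ennreal (Q_deriv a v / (pi * sqrt (v * (4 - v)))) * indicator {0..4} v \<partial>lborel)"
    by (rule nn_integral_unit_lborel_cos) simp
  also have "\<dots> = (\<integral>\<^sup>+v. ennreal (G (g v) * (a * (a - 3) / (a + 1 - v)\<^sup>2)) * indicator {0..4} v \<partial>lborel)"
  proof (rule nn_integral_cong_AE)
    show "AE v in lborel. ennreal (Q_deriv a v / (pi * sqrt (v * (4 - v)))) * indicator {0..4} v =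
        ennreal (G (g v) * (a * (a - 3) / (a + 1 - v)\<^sup>2)) * indicator {0..4} v"
      using AE_lborel_singleton[of "0::real"] AE_lborel_singleton[of "4::real"]
      by eventually_elim
        (use R_deriv_moebius[OF a] in \<open>auto simp: G_def g_def split: split_indicator\<close>)
  qed
  also have "\<dots> = (\<integral>\<^sup>+x. ennreal (G x) * indicator {g 0..g 4} x \<partial>lborel)"
  proof (rule nn_integral_substitution_ennreal[symmetric, where g = g and f = G and a = 0 and b = 4])
    show "set_borel_measurable borel {g 0..g 4} G"
      unfolding set_borel_measurable_def by measurable
    show "(g has_real_derivative a * (a - 3) / (a + 1 - v)\<^sup>2) (at v)" if "v \<in> {0..4}" for v
      unfolding g_def using that a
      by (auto intro!: derivative_eq_intros simp: power2_eq_square)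
    show "continuous_on {0..4} (\<lambda>v. a * (a - 3) / (a + 1 - v)\<^sup>2)"
      using a by (intro continuous_intros) auto
  qed (use a in auto)
  also have "\<dots> = (\<integral>\<^sup>+x. ennreal (G x) * indicator {0..4} x \<partial>lborel)"
  proof (rule nn_integral_cong_AE)
    show "AE x in lborel. ennreal (G x) * indicator {g 0..g 4} x = ennreal (G x) * indicator {0..4} x"
      using AE_lborel_singleton[of "0::real"]
    proof eventually_elim
      case (elim x)
      have neg: "\<not> 4 / (a + 1) \<le> x" if "x < 0"
        using that a divide_nonneg_pos[of 4 "a + 1"] by linarith
      show ?case
        using neg elim R_deriv_eq_0[OF a, of x] by (auto simp: g0 g4 G_def split: split_indicator)
    qed
  qed
  also have "\<dots> = (\<integral>\<^sup>+t. R_deriv a (2 + 2 * cos (2 * pi * t)) \<partial>unit_lborel)"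
    unfolding G_def by (rule nn_integral_unit_lborel_cos[symmetric]) simp
  finally show ?thesis .
qed

section \<open>Null sets, scaling, limits and increments of the inner mean\<close>

lemma AE_quadratic_torus_nonzero:
  assumes "A \<noteq> 0 \<or> B \<noteq> 0"
  shows "AE t in unit_lborel. 2 * A * cos (2 * pi * t) + B \<noteq> 0"
proof -
  obtain p q where
    fac: "\<And>z. norm z = 1 \<Longrightarrow> \<bar>2 * A * Re z + B\<bar> =
      max \<bar>A\<bar> ((\<bar>B\<bar> + sqrt (B\<^sup>2 - 4 * A\<^sup>2)) / 2) * (norm (1 - p * z) * norm (1 - q * z))"
    using quadratic_torus_factorization[OF assms] by blast
  show ?thesis
    using AE_one_minus_cis_nonzero[of p 0] AE_one_minus_cis_nonzero[of q 0]
  proof eventually_elim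
    case (elim t)
    with fac[of "cis (2 * pi * t)"] jensen_argument_pos[OF assms] show ?case by auto
  qed
qed

lemma jensen_abs: "jensen A \<bar>B\<bar> = jensen A B"
  by (simp add: jensen_def)

text \<open>Used with \<open>k\<close> the reciprocal of the parameter, to strip the same
  logarithmic growth from both families.\<close>

lemma jensen_scale:
  assumes "0 < k" "A \<noteq> 0 \<or> B \<noteq> 0"
  shows "jensen (k * A) (k * B) = ln k + jensen A B"
proof -
  have "sqrt ((k * B)\<^sup>2 - 4 * (k * A)\<^sup>2) = sqrt (k\<^sup>2 * (B\<^sup>2 - 4 * A\<^sup>2))"
    by (simp add: power_mult_distrib algebra_simps)
  also have "\<dots> = k * sqrt (B\<^sup>2 - 4 * A\<^sup>2)"
    using assms by (simp add: real_sqrt_mult)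
  finally have "jensen (k * A) (k * B) = ln (max (k * \<bar>A\<bar>) (k * ((\<bar>B\<bar> + sqrt (B\<^sup>2 - 4 * A\<^sup>2)) / 2)))"
    using assms by (simp add: jensen_def abs_mult algebra_simps add_divide_distrib)
  also have "\<dots> = ln (k * max \<bar>A\<bar> ((\<bar>B\<bar> + sqrt (B\<^sup>2 - 4 * A\<^sup>2)) / 2))"
    using assms by (simp add: max_mult_distrib_left)
  finally show ?thesis
    using assms jensen_argument_pos[OF assms(2)] by (simp add: jensen_def ln_mult)
qed

lemma tendsto_jensen:
  assumes "(f \<longlongrightarrow> 0) F" "(g \<longlongrightarrow> L) F" "L \<noteq> 0"
  shows "((\<lambda>x. jensen (f x) (g x)) \<longlongrightarrow> ln \<bar>L\<bar>) F"
proof -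
  have "((\<lambda>x. jensen (f x) (g x)) \<longlongrightarrow> ln (max \<bar>0\<bar> ((\<bar>L\<bar> + sqrt (L\<^sup>2 - 4 * 0\<^sup>2)) / 2))) F"
    unfolding jensen_def using assms by (intro tendsto_intros) auto
  then show ?thesis by simp
qed

text \<open>The second claim belongs to the first: \<open>ennreal\<close> truncates at 0, so equal
  values identify the real increments only if these are nonnegative.\<close>

lemma integral_jensen_diff:
  assumes A [measurable]: "A \<in> borel_measurable borel" and p [measurable]: "p \<in> borel_measurable borel"
    and q [measurable]: "q \<in> borel_measurable borel"
    and int: "integrable unit_lborel (\<lambda>t. jensen (A t) (p t + q t * a))"
      "integrable unit_lborel (\<lambda>t. jensen (A t) (p t + q t * b))"
    and gen: "AE t in unit_lborel. A t \<noteq> 0 \<and> 0 < q t \<and> - 2 * \<bar>A t\<bar> \<le> p t + q t * a"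
    and ab: "a \<le> b"
  shows "ennreal ((\<integral>t. jensen (A t) (p t + q t * b) \<partial>unit_lborel) - (\<integral>t. jensen (A t) (p t + q t * a) \<partial>unit_lborel)) =
      (\<integral>\<^sup>+x. (\<integral>\<^sup>+t. ennreal (q t * jensen_deriv (A t) (p t + q t * x)) \<partial>unit_lborel) * indicator {a..b} x \<partial>lborel)"
    and "(\<integral>t. jensen (A t) (p t + q t * a) \<partial>unit_lborel) \<le> (\<integral>t. jensen (A t) (p t + q t * b) \<partial>unit_lborel)"
proof -
  interpret pair_sigma_finite unit_lborel lborel ..
  have [measurable]: "A \<in> borel_measurable unit_lborel" "p \<in> borel_measurable unit_lborel"
    "q \<in> borel_measurable unit_lborel" by measurable
  let ?D = "\<lambda>t. jensen (A t) (p t + q t * b) - jensen (A t) (p t + q t * a)"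
  have mono: "AE t in unit_lborel. 0 \<le> ?D t"
    using gen by eventually_elim (use jensen_mono ab in auto)
  have "ennreal (\<integral>t. ?D t \<partial>unit_lborel) = (\<integral>\<^sup>+t. ennreal (?D t) \<partial>unit_lborel)"
    using int mono by (intro nn_integral_eq_integral[symmetric] Bochner_Integration.integrable_diff)
  also have "\<dots> = (\<integral>\<^sup>+t. (\<integral>\<^sup>+x. ennreal (q t * jensen_deriv (A t) (p t + q t * x)) * indicator {a..b} x \<partial>lborel) \<partial>unit_lborel)"
  proof (rule nn_integral_cong_AE)
    show "AE t in unit_lborel. ennreal (?D t) =
        (\<integral>\<^sup>+x. ennreal (q t * jensen_deriv (A t) (p t + q t * x)) * indicator {a..b} x \<partial>lborel)"
      using gen by eventually_elim (use ab in \<open>auto simp: nn_integral_jensen_deriv\<close>)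
  qed
  also have "\<dots> = (\<integral>\<^sup>+x. (\<integral>\<^sup>+t. ennreal (q t * jensen_deriv (A t) (p t + q t * x)) * indicator {a..b} x \<partial>unit_lborel) \<partial>lborel)"
    by (rule Fubini'[symmetric]) (simp add: case_prod_beta)
  also have "\<dots> = (\<integral>\<^sup>+x. (\<integral>\<^sup>+t. ennreal (q t * jensen_deriv (A t) (p t + q t * x)) \<partial>unit_lborel) * indicator {a..b} x \<partial>lborel)"
    by (intro nn_integral_cong nn_integral_multc) simp
  finally show "ennreal ((\<integral>t. jensen (A t) (p t + q t * b) \<partial>unit_lborel) - (\<integral>t. jensen (A t) (p t + q t * a) \<partial>unit_lborel)) =
      (\<integral>\<^sup>+x. (\<integral>\<^sup>+t. ennreal (q t * jensen_deriv (A t) (p t + q t * x)) \<partial>unit_lborel) * indicator {a..b} x \<partial>lborel)"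
    using int by simp
  show "(\<integral>t. jensen (A t) (p t + q t * a) \<partial>unit_lborel) \<le> (\<integral>t. jensen (A t) (p t + q t * b) \<partial>unit_lborel)"
    using int mono by (intro integral_mono_AE) auto
qed

section \<open>Comparison of the two families\<close>

text \<open>This is \<open>|1 + x|^2\<close> for \<open>x = cis (2 * pi * t)\<close>, the
  \<open>w\<close> of the overview.\<close>

definition chord2 :: "real \<Rightarrow> real" where
  "chord2 t = 2 + 2 * cos (2 * pi * t)"

lemma chord2_bounds: "0 \<le> chord2 t" "chord2 t \<le> 4"
  using cos_ge_minus_one[of "2 * pi * t"] cos_le_one[of "2 * pi * t"] unfolding chord2_def by linarith+

lemma chord2_eq: "chord2 t = (2 * cos (pi * t))\<^sup>2"
  using cos_double_cos[of "pi * t"] by (simp add: chord2_def power_mult_distrib mult.assoc)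

lemma borel_measurable_chord2 [measurable]: "chord2 \<in> borel_measurable borel"
  unfolding chord2_def by measurable

lemma AE_chord2: "AE t in unit_lborel. 0 < chord2 t \<and> chord2 t \<noteq> 1"
  using AE_quadratic_torus_nonzero[of 1 2, simplified] AE_quadratic_torus_nonzero[of 1 1, simplified]
proof eventually_elim
  case (elim t)
  then show ?case using chord2_bounds(1)[of t] by (auto simp: chord2_def less_le add.commute)
qed

text \<open>Twice the Mahler measure of \<open>1 + x\<close>: the borderline case
  \<open>|B| = 2 * |A|\<close> with \<open>A = 1\<close>.\<close>

lemma has_bochner_integral_ln_chord2: "has_bochner_integral unit_lborel (\<lambda>t. ln (chord2 t)) 0"
proof -
  have "\<bar>2 * 1 * cos (2 * pi * (t + 0)) + 2\<bar> = chord2 t" for t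
    using chord2_bounds(1)[of t] by (simp add: chord2_def add.commute)
  then show ?thesis
    using has_bochner_integral_jensen[of 1 0 2] by (simp add: jensen_eq_elliptic)
qed

lemma integrable_ln_chord2_minus_one: "integrable unit_lborel (\<lambda>t. ln \<bar>chord2 t - 1\<bar>)"
  using has_bochner_integral_jensen[of 1 0 1]
  by (simp add: chord2_def has_bochner_integral_iff add.commute)

text \<open>The summand 0 gives this the shape \<open>p t + q t * a\<close> of
  \<open>integral_jensen_diff\<close>, like \<open>R_jensen\<close>.\<close>

definition Q_jensen :: "real \<Rightarrow> real \<Rightarrow> real" where
  "Q_jensen a t = jensen (chord2 t - 1) (0 + sqrt (chord2 t) * a)"

definition R_jensen :: "real \<Rightarrow> real \<Rightarrow> real" where
  "R_jensen a t = jensen (chord2 t - 1) (((chord2 t)\<^sup>2 - 2 * chord2 t - 2) + chord2 t * a)"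

lemma sqrt_chord2_bounds: "0 \<le> sqrt (chord2 t)" "chord2 t / 2 \<le> sqrt (chord2 t)" "sqrt (chord2 t) \<le> 2"
proof -
  show le2: "sqrt (chord2 t) \<le> 2" using chord2_bounds[of t] by (intro real_le_lsqrt) auto
  show "0 \<le> sqrt (chord2 t)" using chord2_bounds by simp
  then have "sqrt (chord2 t) * sqrt (chord2 t) \<le> sqrt (chord2 t) * 2" using le2 by (rule mult_left_mono[rotated])
  then show "chord2 t / 2 \<le> sqrt (chord2 t)" using chord2_bounds[of t] by simp
qed

text \<open>Term by term on \<open>{0..4}\<close>: \<open>26 = 16 + 8 + 2\<close>.\<close>

lemma R_poly_bounds: "\<bar>(chord2 t)\<^sup>2 - 2 * chord2 t - 2\<bar> \<le> 26"
proof -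
  have "chord2 t * chord2 t \<le> 4 * 4" using chord2_bounds[of t] by (intro mult_mono) auto
  moreover have "0 \<le> chord2 t * chord2 t" by simp
  ultimately show ?thesis using chord2_bounds[of t] unfolding power2_eq_square by linarith
qed

lemma integrable_Q_jensen: "integrable unit_lborel (Q_jensen a)"
  unfolding Q_jensen_def
proof (rule integrable_jensen[where c = "3 + 2 * \<bar>a\<bar>"])
  fix t
  have "\<bar>sqrt (chord2 t) * a\<bar> \<le> 2 * \<bar>a\<bar>"
    unfolding abs_mult using sqrt_chord2_bounds[of t] by (intro mult_right_mono) auto
  then show "\<bar>chord2 t - 1\<bar> \<le> 3 + 2 * \<bar>a\<bar> \<and> \<bar>0 + sqrt (chord2 t) * a\<bar> \<le> 3 + 2 * \<bar>a\<bar>"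
    using chord2_bounds[of t] by auto
next
  show "AE t in unit_lborel. chord2 t - 1 \<noteq> 0" using AE_chord2 by eventually_elim auto
qed (simp_all add: integrable_ln_chord2_minus_one)

lemma integrable_R_jensen: "integrable unit_lborel (R_jensen a)"
  unfolding R_jensen_def
proof (rule integrable_jensen[where c = "26 + 4 * \<bar>a\<bar>"])
  fix t
  have "\<bar>chord2 t * a\<bar> \<le> 4 * \<bar>a\<bar>"
    unfolding abs_mult using chord2_bounds[of t] by (intro mult_right_mono) auto
  then show "\<bar>chord2 t - 1\<bar> \<le> 26 + 4 * \<bar>a\<bar> \<and> \<bar>((chord2 t)\<^sup>2 - 2 * chord2 t - 2) + chord2 t * a\<bar> \<le> 26 + 4 * \<bar>a\<bar>"
    using chord2_bounds[of t] R_poly_bounds[of t] by (intro conjI; linarith)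
next
  show "AE t in unit_lborel. chord2 t - 1 \<noteq> 0" using AE_chord2 by eventually_elim auto
qed (simp_all add: integrable_ln_chord2_minus_one)

lemma integral_Q_R_jensen_diff:
  assumes a: "4 \<le> a" "a \<le> b"
  shows "integral\<^sup>L unit_lborel (Q_jensen b) - integral\<^sup>L unit_lborel (Q_jensen a) =
    integral\<^sup>L unit_lborel (R_jensen b) - integral\<^sup>L unit_lborel (R_jensen a)"
proof -
  have genQ: "AE t in unit_lborel. chord2 t - 1 \<noteq> 0 \<and> 0 < sqrt (chord2 t) \<and> - 2 * \<bar>chord2 t - 1\<bar> \<le> 0 + sqrt (chord2 t) * a"
    using AE_chord2
  proof eventually_elim
    case (elim t)
    have "- 2 * \<bar>chord2 t - 1\<bar> \<le> 0" by simp
    also have "0 \<le> 0 + sqrt (chord2 t) * a" using a chord2_bounds[of t] by simp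
    finally have "- 2 * \<bar>chord2 t - 1\<bar> \<le> 0 + sqrt (chord2 t) * a" .
    with elim show ?case by simp
  qed
  have genR: "AE t in unit_lborel. chord2 t - 1 \<noteq> 0 \<and> 0 < chord2 t \<and>
      - 2 * \<bar>chord2 t - 1\<bar> \<le> ((chord2 t)\<^sup>2 - 2 * chord2 t - 2) + chord2 t * a"
    using AE_chord2
  proof eventually_elim
    case (elim t)
    define y where "y = chord2 t * a"
    have "chord2 t * 4 \<le> y" unfolding y_def using a chord2_bounds[of t] by (intro mult_left_mono) auto
    moreover define w where "w = (chord2 t)\<^sup>2"
    then have "0 \<le> w" by simp
    moreover define m where "m = \<bar>chord2 t - 1\<bar>"
    then have "1 - chord2 t \<le> m" by simp
    \<comment> \<open>With \<open>v = chord2 t\<close> and \<open>a \<ge> 4\<close>, the right side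
      plus \<open>2 * (1 - v)\<close> is at least \<open>v^2\<close>.\<close>
    ultimately have "- 2 * \<bar>chord2 t - 1\<bar> \<le> ((chord2 t)\<^sup>2 - 2 * chord2 t - 2) + chord2 t * a"
      unfolding w_def[symmetric] y_def[symmetric] m_def[symmetric] by linarith
    with elim show ?case by simp
  qed
  have intQ: "integrable unit_lborel (\<lambda>t. jensen (chord2 t - 1) (0 + sqrt (chord2 t) * x))" for x
    using integrable_Q_jensen[of x] by (simp add: Q_jensen_def[abs_def])
  have intR: "integrable unit_lborel (\<lambda>t. jensen (chord2 t - 1) (((chord2 t)\<^sup>2 - 2 * chord2 t - 2) + chord2 t * x))" for x
    using integrable_R_jensen[of x] by (simp add: R_jensen_def[abs_def])
  have m: "(\<lambda>t. chord2 t - 1) \<in> borel_measurable borel" "(\<lambda>t. 0) \<in> borel_measurable borel"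
      "(\<lambda>t. sqrt (chord2 t)) \<in> borel_measurable borel" "(\<lambda>t. (chord2 t)\<^sup>2 - 2 * chord2 t - 2) \<in> borel_measurable borel"
    by measurable
  note Q = integral_jensen_diff[OF m(1) m(2) m(3) intQ intQ genQ a(2)]
  note R = integral_jensen_diff[OF m(1) m(4) borel_measurable_chord2 intR intR genR a(2)]
  have "(\<integral>\<^sup>+t. ennreal (sqrt (chord2 t) * jensen_deriv (chord2 t - 1) (0 + sqrt (chord2 t) * x)) \<partial>unit_lborel) =
      (\<integral>\<^sup>+t. ennreal (chord2 t * jensen_deriv (chord2 t - 1) (((chord2 t)\<^sup>2 - 2 * chord2 t - 2) + chord2 t * x)) \<partial>unit_lborel)"
    if "a \<le> x" for x
    using nn_integral_Q_deriv_eq_R_deriv[of x] that a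
    by (simp add: Q_deriv_def R_deriv_def chord2_def mult.commute)
  then have "(\<integral>\<^sup>+x. (\<integral>\<^sup>+t. ennreal (sqrt (chord2 t) * jensen_deriv (chord2 t - 1) (0 + sqrt (chord2 t) * x)) \<partial>unit_lborel) * indicator {a..b} x \<partial>lborel) =
      (\<integral>\<^sup>+x. (\<integral>\<^sup>+t. ennreal (chord2 t * jensen_deriv (chord2 t - 1) (((chord2 t)\<^sup>2 - 2 * chord2 t - 2) + chord2 t * x)) \<partial>unit_lborel) * indicator {a..b} x \<partial>lborel)"
    by (intro nn_integral_cong) (auto split: split_indicator)
  from trans[OF Q(1) trans[OF this R(1)[symmetric]]] show ?thesis
    unfolding Q_jensen_def[abs_def] R_jensen_def[abs_def]
    by (rule ennreal_inj[THEN iffD1, rotated 2]) (use Q(2) R(2) in simp_all)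
qed

text \<open>Both terms lie between \<open>ln (a * chord2 t / 8)\<close> and
  \<open>ln (10 * a)\<close>. The parameter cancels in the difference of these bounds, which leaves
  an integrable function of \<open>t\<close>.\<close>

lemma Q_jensen_minus_R_jensen_bound:
  assumes a: "8 \<le> a" and v: "0 < chord2 t"
  shows "\<bar>Q_jensen a t - R_jensen a t\<bar> \<le> ln 80 - ln (chord2 t)"
proof -
  let ?l = "ln (a * chord2 t / 8)" and ?u = "ln (10 * a)"
  let ?A = "chord2 t - 1" and ?BQ = "0 + sqrt (chord2 t) * a" and ?BR = "((chord2 t)\<^sup>2 - 2 * chord2 t - 2) + chord2 t * a"
  have l: "0 < a * chord2 t / 8" using a v by simp
  have A: "\<bar>?A\<bar> \<le> 10 * a" using chord2_bounds[of t] a by auto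
  have nz: "?A \<noteq> 0 \<or> B \<noteq> 0" if "0 < max \<bar>?A\<bar> (\<bar>B\<bar> / 2)" for B
    using that by auto
  have sq: "chord2 t / 2 * a \<le> sqrt (chord2 t) * a" "sqrt (chord2 t) * a \<le> 2 * a"
    using sqrt_chord2_bounds[of t] a by (auto intro!: mult_right_mono)
  have va: "chord2 t * 8 \<le> chord2 t * a" "chord2 t * a \<le> 4 * a"
    using chord2_bounds[of t] a by (intro mult_left_mono mult_right_mono; simp)+
  have BQ: "0 \<le> ?BQ" "?BQ \<le> 10 * a" using sq a chord2_bounds[of t] by simp_all
  have Q_lo: "a * chord2 t / 8 \<le> max \<bar>?A\<bar> (\<bar>?BQ\<bar> / 2)"
    using sq v a l by (intro max.coboundedI2) (simp add: mult.commute)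
  define w where "w = (chord2 t)\<^sup>2"
  then have "0 \<le> w" by simp
  moreover define y where "y = chord2 t * a"
  \<comment> \<open>With \<open>v = chord2 t\<close> the right side is
    \<open>v^2 + v * (a - 4)\<close>, and \<open>a - 4 \<ge> a / 2\<close> because
    \<open>a \<ge> 8\<close>. As \<open>2 |A| + |B|\<close> is at most four times
    \<open>max |A| (|B| / 2)\<close>, the divisor 8 results.\<close>
  ultimately have "chord2 t * a / 2 \<le> 2 * (- ?A) + ?BR"
    using va unfolding w_def[symmetric] y_def[symmetric] by simp
  also have "\<dots> \<le> 2 * \<bar>?A\<bar> + \<bar>?BR\<bar>"
    by (rule add_mono, rule mult_left_mono) simp_all
  finally have "chord2 t * a / 2 \<le> 2 * \<bar>?A\<bar> + \<bar>?BR\<bar>" .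
  moreover have "z / 8 \<le> max x (y / 2)" if "z / 2 \<le> 2 * x + y" for x y z :: real
    using that by (simp add: max_def)
  ultimately have R_lo: "a * chord2 t / 8 \<le> max \<bar>?A\<bar> (\<bar>?BR\<bar> / 2)"
    unfolding mult.commute[of a] by blast
  have "\<bar>chord2 t * a\<bar> \<le> 4 * a" using va a v by simp
  then have BR: "\<bar>?BR\<bar> \<le> 10 * a"
    using abs_triangle_ineq[of "(chord2 t)\<^sup>2 - 2 * chord2 t - 2" "chord2 t * a"] R_poly_bounds[of t] a by simp
  note nzQ = nz[OF less_le_trans[OF l Q_lo]] and nzR = nz[OF less_le_trans[OF l R_lo]]
  have "?l \<le> Q_jensen a t" "?l \<le> R_jensen a t"
    unfolding Q_jensen_def R_jensen_def
    by (fact jensen_lower[OF nzQ l Q_lo], fact jensen_lower[OF nzR l R_lo])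
  moreover have "Q_jensen a t \<le> ?u" "R_jensen a t \<le> ?u"
    unfolding Q_jensen_def R_jensen_def
    by (rule jensen_upper[OF nzQ A], use BQ in simp, rule jensen_upper[OF nzR A BR])
  moreover have "?u - ?l = ln 80 - ln (chord2 t)"
  proof -
    have "?u - ?l = ln (10 * a / (a * chord2 t / 8))"
      by (rule ln_divide_pos[symmetric]) (use a l in simp_all)
    also have "10 * a / (a * chord2 t / 8) = 80 / chord2 t" using a v by (simp add: field_simps)
    finally show ?thesis using v by (simp add: ln_div)
  qed
  ultimately show ?thesis by linarith
qed

text \<open>After division by the parameter, \<open>A\<close> tends to 0 while \<open>B\<close>
  tends to \<open>sqrt (chord2 t)\<close> for \<open>Q\<close> and to \<open>chord2 t\<close> for
  \<open>R\<close>. Only the logarithms of these limits survive.\<close>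

lemma Q_jensen_minus_R_jensen_tendsto:
  assumes v: "0 < chord2 t"
  shows "(\<lambda>n. Q_jensen (8 + real n) t - R_jensen (8 + real n) t) \<longlonglongrightarrow> - (ln (chord2 t) / 2)"
proof -
  define p where "p = (chord2 t)\<^sup>2 - 2 * chord2 t - 2"
  define k where "k n = 1 / (8 + real n)" for n
  have k: "0 < k n" "(8 + real n) = 1 / k n" for n by (simp_all add: k_def)
  have "filterlim (\<lambda>n. 8 + real n) at_top sequentially"
    by (intro filterlim_tendsto_add_at_top[OF tendsto_const] filterlim_real_sequentially)
  then have k0: "k \<longlonglongrightarrow> 0"
    unfolding k_def by (intro tendsto_divide_0[OF tendsto_const] filterlim_at_top_imp_at_infinity)
  have Q: "ln (k n) + Q_jensen (8 + real n) t = jensen (k n * (chord2 t - 1)) (sqrt (chord2 t))" for n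
    using jensen_scale[OF k(1), of "chord2 t - 1" "sqrt (chord2 t) * (8 + real n)" n] v k(1)[of n]
    by (simp add: Q_jensen_def k(2))
  \<comment> \<open>If \<open>chord2 t = 1\<close> then \<open>p = -3\<close>, and the first term is
    at least 5.\<close>
  have "p + chord2 t * x \<noteq> 0 \<or> chord2 t - 1 \<noteq> 0" if "8 \<le> x" for x
    using that by (auto simp: p_def power2_eq_square)
  then have "chord2 t - 1 \<noteq> 0 \<or> p + chord2 t * (8 + real n) \<noteq> 0" for n by force
  then have R: "ln (k n) + R_jensen (8 + real n) t = jensen (k n * (chord2 t - 1)) (k n * p + chord2 t)" for n
    using jensen_scale[OF k(1), of "chord2 t - 1" "p + chord2 t * (8 + real n)" n] k(1)[of n]
    unfolding R_jensen_def p_def[symmetric] by (simp add: k(2) distrib_left)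
  have "(\<lambda>n. jensen (k n * (chord2 t - 1)) (sqrt (chord2 t)) - jensen (k n * (chord2 t - 1)) (k n * p + chord2 t))
      \<longlonglongrightarrow> ln \<bar>sqrt (chord2 t)\<bar> - ln \<bar>chord2 t\<bar>"
    using v k0 by (intro tendsto_diff tendsto_jensen tendsto_mult_left_zero tendsto_const)
      (auto intro!: tendsto_eq_intros)
  moreover have "ln \<bar>sqrt (chord2 t)\<bar> - ln \<bar>chord2 t\<bar> = - (ln (chord2 t) / 2)"
    using v by (simp add: ln_sqrt)
  moreover have "Q_jensen (8 + real n) t - R_jensen (8 + real n) t =
      jensen (k n * (chord2 t - 1)) (sqrt (chord2 t)) - jensen (k n * (chord2 t - 1)) (k n * p + chord2 t)" for n
    using Q[of n] R[of n] by linarith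
  ultimately show ?thesis by simp
qed

lemma integral_Q_jensen_eq_R_jensen:
  assumes a: "4 \<le> a"
  shows "integral\<^sup>L unit_lborel (Q_jensen a) = integral\<^sup>L unit_lborel (R_jensen a)"
proof -
  define D where "D a = integral\<^sup>L unit_lborel (Q_jensen a) - integral\<^sup>L unit_lborel (R_jensen a)" for a
  have const: "D x = D 4" if "4 \<le> x" for x
    using integral_Q_R_jensen_diff[of 4 x] that by (simp add: D_def)
  \<comment> \<open>The offset 8 keeps the whole sequence in the range of the dominating bound. Each
    term equals \<open>D 4\<close>, so the limit is its value.\<close>
  have "(\<lambda>n. \<integral>t. Q_jensen (8 + real n) t - R_jensen (8 + real n) t \<partial>unit_lborel)
      \<longlonglongrightarrow> (\<integral>t. - (ln (chord2 t) / 2) \<partial>unit_lborel)"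
  proof (rule integral_dominated_convergence[where w = "\<lambda>t. ln 80 - ln (chord2 t)"])
    show "integrable unit_lborel (\<lambda>t. ln 80 - ln (chord2 t))"
      using has_bochner_integral_ln_chord2 by (simp add: has_bochner_integral_iff)
    show "AE t in unit_lborel. (\<lambda>n. Q_jensen (8 + real n) t - R_jensen (8 + real n) t) \<longlonglongrightarrow> - (ln (chord2 t) / 2)"
      using AE_chord2 by eventually_elim (use Q_jensen_minus_R_jensen_tendsto in auto)
    show "AE t in unit_lborel. norm (Q_jensen (8 + real n) t - R_jensen (8 + real n) t) \<le> ln 80 - ln (chord2 t)" for n
      using AE_chord2 by eventually_elim (use Q_jensen_minus_R_jensen_bound[of "8 + real n"] in auto)
    show "(\<lambda>t. Q_jensen (8 + real n) t - R_jensen (8 + real n) t) \<in> borel_measurable unit_lborel" for n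
      using integrable_Q_jensen integrable_R_jensen by (intro borel_measurable_diff borel_measurable_integrable)
  qed simp
  moreover have "(\<integral>t. Q_jensen (8 + real n) t - R_jensen (8 + real n) t \<partial>unit_lborel) = D 4" for n
    using const[of "8 + real n"] integrable_Q_jensen integrable_R_jensen by (simp add: D_def)
  moreover have "(\<integral>t. - (ln (chord2 t) / 2) \<partial>unit_lborel) = 0"
    using has_bochner_integral_integral_eq[OF has_bochner_integral_ln_chord2] by simp
  ultimately have "D 4 = 0" by (simp add: LIMSEQ_const_iff)
  with const[OF a] show ?thesis by (simp add: D_def)
qed

section \<open>Real normal forms of the two polynomials on the torus, and the conclusion\<close>

lemma mult_cnj_of_norm_1: "norm z = 1 \<Longrightarrow> z * cnj z = 1"
  by (simp add: complex_norm_square[symmetric])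

text \<open>\<open>Q\<close> is self-reciprocal: with \<open>x = u^2\<close> and
  \<open>y = u * z\<close>, division by the unit \<open>u^4 * z\<close> leaves an expression fixed
  by conjugation, hence real. The square root \<open>u\<close> of \<open>x\<close> is responsible
  for the half angle.\<close>

lemma norm_Q_torus:
  "norm (Q a (cis (2 * pi * t)) (cis (2 * pi * s))) =
    \<bar>2 * (chord2 t - 1) * cos (2 * pi * (s + - t / 2)) + 2 * a * cos (pi * t)\<bar>"
proof -
  define u where "u = cis (pi * t)"
  define z where "z = cis (2 * pi * (s + - t / 2))"
  have x: "cis (2 * pi * t) = u\<^sup>2"
    by (simp add: u_def power2_eq_square cis_mult mult.assoc)
  have y: "cis (2 * pi * s) = u * z"
    by (simp add: u_def z_def cis_mult algebra_simps)
  have uz: "u * cnj u = 1" "z * cnj z = 1"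
    by (simp_all add: mult_cnj_of_norm_1 u_def z_def)
  have "Q a (u\<^sup>2) (u * z) = u ^ 4 * z * ((u\<^sup>2 + cnj u ^ 2 + 1) * (z + cnj z) + of_real a * (u + cnj u))"
    unfolding Q_def using uz by algebra
  also have "u\<^sup>2 + cnj u ^ 2 + 1 = of_real (chord2 t - 1)"
  proof -
    have "Re (u\<^sup>2) = cos (2 * pi * t)" by (simp flip: x)
    with complex_add_cnj[of "u\<^sup>2"] show ?thesis by (simp add: chord2_def)
  qed
  also have "z + cnj z = of_real (2 * cos (2 * pi * (s + - t / 2)))"
    by (simp add: complex_add_cnj z_def)
  also have "u + cnj u = of_real (2 * cos (pi * t))"
    by (simp add: complex_add_cnj u_def)
  also have "of_real (chord2 t - 1) * of_real (2 * cos (2 * pi * (s + - t / 2))) + of_real a * of_real (2 * cos (pi * t)) =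
      (of_real (2 * (chord2 t - 1) * cos (2 * pi * (s + - t / 2)) + 2 * a * cos (pi * t)) :: complex)"
    by simp
  finally have eq: "Q a (u\<^sup>2) (u * z) = u ^ 4 * z *
    of_real (2 * (chord2 t - 1) * cos (2 * pi * (s + - t / 2)) + 2 * a * cos (pi * t))" .
  show ?thesis
    unfolding x y eq norm_mult norm_power norm_of_real by (simp add: u_def z_def)
qed

text \<open>As for \<open>Q\<close>, now with \<open>y = x * z\<close> and the unit
  \<open>x^3 * z\<close>. For \<open>w = chord2 t\<close> the middle coefficient of
  \<open>R \<beta>\<close> becomes \<open>w^2 + (\<beta> - 4) * w - 2\<close>, and
  \<open>\<beta> = 2 + a\<close> gives the stated form.\<close>

lemma norm_R_torus:
  "norm (R (2 + a) (cis (2 * pi * t)) (cis (2 * pi * s))) =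
    \<bar>2 * (chord2 t - 1) * cos (2 * pi * (s + - t)) + (((chord2 t)\<^sup>2 - 2 * chord2 t - 2) + chord2 t * a)\<bar>"
proof -
  define x where "x = cis (2 * pi * t)"
  define z where "z = cis (2 * pi * (s + - t))"
  have y: "cis (2 * pi * s) = x * z"
    by (simp add: x_def z_def cis_mult algebra_simps)
  have xz: "x * cnj x = 1" "z * cnj z = 1"
    by (simp_all add: mult_cnj_of_norm_1 x_def z_def)
  have X: "x + cnj x = of_real (chord2 t - 2)"
    by (simp add: complex_add_cnj x_def chord2_def)
  have "R (2 + a) x (x * z) = x ^ 3 * z * ((x + cnj x + 1) * (z + cnj z) +
      ((x + cnj x)\<^sup>2 - 2 + (2 + of_real a) * (x + cnj x) + 2 * (2 + of_real a) - 4))"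
    unfolding R_def of_real_add of_real_numeral using xz by algebra
  also have "\<dots> = x ^ 3 * z * of_real (2 * (chord2 t - 1) * cos (2 * pi * (s + - t)) + (((chord2 t)\<^sup>2 - 2 * chord2 t - 2) + chord2 t * a))"
  proof -
    have "z + cnj z = of_real (2 * cos (2 * pi * (s + - t)))"
      by (simp add: complex_add_cnj z_def)
    then show ?thesis unfolding X
      by (simp add: algebra_simps power2_eq_square)
  qed
  finally have eq: "R (2 + a) x (x * z) = x ^ 3 * z *
    of_real (2 * (chord2 t - 1) * cos (2 * pi * (s + - t)) + (((chord2 t)\<^sup>2 - 2 * chord2 t - 2) + chord2 t * a))" .
  show ?thesis
    unfolding y x_def[symmetric] eq norm_mult norm_power norm_of_real by (simp add: x_def z_def)
qed

theorem theorem2: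
  fixes \<alpha> :: real
  assumes "\<alpha> \<ge> 4"
  shows "mahler_measure (\<lambda>z :: complex ^ 2. Q \<alpha> (z $ 1) (z $ 2)) =
         mahler_measure (\<lambda>z :: complex ^ 2. R (2 + \<alpha>) (z $ 1) (z $ 2))"
proof -
  have A0: "AE t in unit_lborel. chord2 t - 1 \<noteq> 0" using AE_chord2 by eventually_elim auto
  have mA: "(\<lambda>t. chord2 t - 1) \<in> borel_measurable borel" by measurable
  have "mahler_measure (\<lambda>z :: complex ^ 2. Q \<alpha> (z $ 1) (z $ 2)) =
      of_real (\<integral>t. jensen (chord2 t - 1) (2 * \<alpha> * cos (pi * t)) \<partial>unit_lborel)"
  proof (rule mahler_measure_eq_integral_jensen[OF _ norm_Q_torus mA _ _ integrable_ln_chord2_minus_one A0])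
    show "continuous_on UNIV (\<lambda>z :: complex ^ 2. Q \<alpha> (z $ 1) (z $ 2))"
      unfolding Q_def by (intro continuous_intros)
    fix t
    have "\<bar>2 * \<alpha> * cos (pi * t)\<bar> \<le> 2 * \<alpha> * 1"
      using assms unfolding abs_mult by (intro mult_mono) auto
    then show "\<bar>chord2 t - 1\<bar> \<le> 3 + 2 * \<alpha> \<and> \<bar>2 * \<alpha> * cos (pi * t)\<bar> \<le> 3 + 2 * \<alpha>"
      using chord2_bounds[of t] assms by auto
  qed simp
  also have "(\<lambda>t. jensen (chord2 t - 1) (2 * \<alpha> * cos (pi * t))) = Q_jensen \<alpha>"
  proof
    fix t
    \<comment> \<open>The half-angle cosine changes sign on the period; evenness of
      \<open>jensen\<close> in \<open>B\<close> makes this harmless.\<close>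
    have "sqrt (chord2 t) * \<alpha> = \<bar>2 * \<alpha> * cos (pi * t)\<bar>"
      using assms unfolding chord2_eq real_sqrt_abs by (simp add: abs_mult)
    then show "jensen (chord2 t - 1) (2 * \<alpha> * cos (pi * t)) = Q_jensen \<alpha> t"
      by (simp add: Q_jensen_def jensen_abs)
  qed
  also have "integral\<^sup>L unit_lborel (Q_jensen \<alpha>) = integral\<^sup>L unit_lborel (R_jensen \<alpha>)"
    by (rule integral_Q_jensen_eq_R_jensen[OF assms])
  also have "of_real \<dots> = mahler_measure (\<lambda>z :: complex ^ 2. R (2 + \<alpha>) (z $ 1) (z $ 2))"
    unfolding R_jensen_def
  proof (rule mahler_measure_eq_integral_jensen[symmetric, OF _ norm_R_torus mA _ _ integrable_ln_chord2_minus_one A0])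
    show "continuous_on UNIV (\<lambda>z :: complex ^ 2. R (2 + \<alpha>) (z $ 1) (z $ 2))"
      unfolding R_def by (intro continuous_intros)
    fix t
    have "chord2 t * \<alpha> \<le> 4 * \<alpha>" "0 \<le> chord2 t * \<alpha>"
      using chord2_bounds[of t] assms by (auto intro!: mult_right_mono)
    then show "\<bar>chord2 t - 1\<bar> \<le> 26 + 4 * \<alpha> \<and> \<bar>((chord2 t)\<^sup>2 - 2 * chord2 t - 2) + chord2 t * \<alpha>\<bar> \<le> 26 + 4 * \<alpha>"
      using chord2_bounds[of t] R_poly_bounds[of t] assms by (intro conjI; linarith)
  qed simp
  finally show ?thesis .
qed

end
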